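(* Let $G$ be a finite group and let $S\subseteq N(G)$ be an arbitrary set of normal subgroups of $G$. Then $$\left(\{\mathcal{X}^{N^{\bullet}}\neq \emptyset: N\in A(S)\},\ \{N^\circ \neq \emptyset: N\in A(S)\}\right)$$ is an integral supercharacter theory of $G$ (with supercharacters the nonzero characters among $\chi^{N^\bullet}$, $N\in A(S)$). Moreover, for every $N\in A(S)$ and every $g\in G$, $$\chi^{N^\bullet}(g)=\sum_{\substack{M\in A(S):\\ g\in M,\ N\subseteq M}}\mu(N,M)\frac{|G|}{|M|},$$ where $\mu$ is the Möbius function of the poset $(A(S),\subseteq)$.
   Context: $N(G)$ denotes the set of all normal subgroups of the finite group $G$; it is a semigroup under the product of subgroups. For $S\subseteq N(G)$, $A(S)$ is the smallest subsemigroup of $N(G)$ (i.e. closed under products $NH$) such that $\{1\},G\in A(S)$, $S\subseteq A(S)$, and $A(S)$ is closed under intersection. The symbol $\subset$ denotes strict inclusion. $\mathrm{Irr}(G)$ is the set of irreducible complex characters of $G$ and $\ker\psi=\{g\in G:\psi(g)=\psi(1)\}$. For $N\in A(S)$: $N^\circ := N\setminus\bigcup_{H\in A(S),\,H\subset N}H$; $\mathcal{X}^N:=\{\psi\in\mathrm{Irr}(G): N\subseteq\ker\psi\}$; $\mathcal{X}^{N^\bullet}:=\mathcal{X}^N\setminus\bigcup_{K\in A(S),\,N\subset K}\mathcal{X}^K$; $\chi^{N^\bullet}:=\sum_{\psi\in\mathcal{X}^{N^\bullet}}\psi(1)\psi$ (equal to $0$ if $\mathcal{X}^{N^\bullet}=\emptyset$).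 A supercharacter theory of a finite group $G$ is a pair $(\mathcal{X},\mathcal{K})$ together with a choice of characters $\{\chi_X:X\in\mathcal{X}\}$ (called supercharacters; each $\chi_X$ is a constant multiple of $\sum_{\psi\in X}\psi(1)\psi$), where $\mathcal{X}$ is a partition of $\mathrm{Irr}(G)$ and $\mathcal{K}$ is a partition of $G$, such that: (1) $\{1\}\in\mathcal{K}$; (2) $|\mathcal{X}|=|\mathcal{K}|$; (3) each $\chi_X$ is constant on the parts of $\mathcal{K}$. The members of $\mathcal{K}$ are called superclasses. A character is integral if all of its values lie in $\mathbb{Q}$; a supercharacter theory is integral if all its supercharacters are integral. The Möbius function of a finite poset $P$ is the function on pairs $s\le u$ determined by $\mu(s,s)=1$ and $\sum_{s\le t\le u}\mu(t,u)=0$ for $s<u$. *)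

theory Defs
  imports
    "HOL-Algebra.Coset"
    "HOL-Library.Disjoint_Sets"
    "Jordan_Normal_Form.VS_Connect"
begin

section \<open>Complex characters\<close>

definition GL :: "nat \<Rightarrow> complex mat monoid" where
  "GL n = units_of (ring_mat TYPE(complex) n ())"

definition is_rep :: "('a, 'b) monoid_scheme \<Rightarrow> nat \<Rightarrow> ('a \<Rightarrow> complex mat) \<Rightarrow> bool" where
  "is_rep G n \<rho> \<longleftrightarrow> \<rho> \<in> hom G (GL n)"

definition invariant_subspace ::
  "('a, 'b) monoid_scheme \<Rightarrow> nat \<Rightarrow> ('a \<Rightarrow> complex mat) \<Rightarrow> complex vec set \<Rightarrow> bool" where
  "invariant_subspace G n \<rho> W \<longleftrightarrow>
     VectorSpace.subspace class_ring W (module_vec TYPE(complex) n) \<and>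
     (\<forall>g\<in>carrier G. \<forall>w\<in>W. \<rho> g *\<^sub>v w \<in> W)"

definition irreducible_rep ::
  "('a, 'b) monoid_scheme \<Rightarrow> nat \<Rightarrow> ('a \<Rightarrow> complex mat) \<Rightarrow> bool" where
  "irreducible_rep G n \<rho> \<longleftrightarrow>
     is_rep G n \<rho> \<and> 0 < n \<and>
     (\<forall>W. invariant_subspace G n \<rho> W \<longrightarrow> W = {0\<^sub>v n} \<or> W = carrier_vec n)"

text \<open>Characters are extended by \<open>0\<close> outside the carrier, so that two characters are equal
  as functions iff they agree on the group.\<close>

definition rep_character ::
  "('a, 'b) monoid_scheme \<Rightarrow> nat \<Rightarrow> ('a \<Rightarrow> complex mat) \<Rightarrow> 'a \<Rightarrow> complex" where
  "rep_character G n \<rho> = (\<lambda>g. if g \<in> carrier G then \<Sum>i<n. \<rho> g $$ (i, i) else 0)"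

text \<open>A character has positive degree; the zero function is not a character.\<close>

definition is_character :: "('a, 'b) monoid_scheme \<Rightarrow> ('a \<Rightarrow> complex) \<Rightarrow> bool" where
  "is_character G \<chi> \<longleftrightarrow> (\<exists>n \<rho>. 0 < n \<and> is_rep G n \<rho> \<and> \<chi> = rep_character G n \<rho>)"

definition Irr :: "('a, 'b) monoid_scheme \<Rightarrow> ('a \<Rightarrow> complex) set" where
  "Irr G = {rep_character G n \<rho> |n \<rho>. irreducible_rep G n \<rho>}"

definition char_ker :: "('a, 'b) monoid_scheme \<Rightarrow> ('a \<Rightarrow> complex) \<Rightarrow> 'a set" where
  "char_ker G \<psi> = {g \<in> carrier G. \<psi> g = \<psi> \<one>\<^bsub>G\<^esub>}"

definition weighted_sum ::
  "('a, 'b) monoid_scheme \<Rightarrow> ('a \<Rightarrow> complex) set \<Rightarrow> 'a \<Rightarrow> complex" where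
  "weighted_sum G X = (\<lambda>g. \<Sum>\<psi>\<in>X. \<psi> \<one>\<^bsub>G\<^esub> * \<psi> g)"

section \<open>Supercharacter theories\<close>

text \<open>The function \<open>\<chi>\<close> is the choice of supercharacters \<open>X \<mapsto> \<chi>\<^sub>X\<close>; only its values on
  \<open>\<X>\<close> matter.\<close>

definition supercharacter_theory ::
  "('a, 'b) monoid_scheme \<Rightarrow> ('a \<Rightarrow> complex) set set \<Rightarrow> 'a set set \<Rightarrow>
   (('a \<Rightarrow> complex) set \<Rightarrow> 'a \<Rightarrow> complex) \<Rightarrow> bool" where
  "supercharacter_theory G \<X> \<K> \<chi> \<longleftrightarrow>
     partition_on (Irr G) \<X> \<and> partition_on (carrier G) \<K> \<and>
     (\<forall>X\<in>\<X>. is_character G (\<chi> X) \<and> (\<exists>c. \<chi> X = (\<lambda>g. c * weighted_sum G X g))) \<and>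
     {\<one>\<^bsub>G\<^esub>} \<in> \<K> \<and>
     card \<X> = card \<K> \<and>
     (\<forall>X\<in>\<X>. \<forall>K\<in>\<K>. \<forall>g\<in>K. \<forall>h\<in>K. \<chi> X g = \<chi> X h)"

definition integral_character :: "('a, 'b) monoid_scheme \<Rightarrow> ('a \<Rightarrow> complex) \<Rightarrow> bool" where
  "integral_character G \<chi> \<longleftrightarrow> is_character G \<chi> \<and> (\<forall>g\<in>carrier G. \<chi> g \<in> \<rat>)"

definition integral_supercharacter_theory ::
  "('a, 'b) monoid_scheme \<Rightarrow> ('a \<Rightarrow> complex) set set \<Rightarrow> 'a set set \<Rightarrow>
   (('a \<Rightarrow> complex) set \<Rightarrow> 'a \<Rightarrow> complex) \<Rightarrow> bool" where
  "integral_supercharacter_theory G \<X> \<K> \<chi> \<longleftrightarrow>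
     supercharacter_theory G \<X> \<K> \<chi> \<and> (\<forall>X\<in>\<X>. integral_character G (\<chi> X))"

section \<open>The semigroup generated by a set of normal subgroups\<close>

inductive_set normal_gen :: "('a, 'b) monoid_scheme \<Rightarrow> 'a set set \<Rightarrow> 'a set set"
  for G :: "('a, 'b) monoid_scheme" and S :: "'a set set" where
  one: "{\<one>\<^bsub>G\<^esub>} \<in> normal_gen G S"
| whole: "carrier G \<in> normal_gen G S"
| base: "N \<in> S \<Longrightarrow> N \<in> normal_gen G S"
| prod: "N \<in> normal_gen G S \<Longrightarrow> H \<in> normal_gen G S \<Longrightarrow> N <#>\<^bsub>G\<^esub> H \<in> normal_gen G S"
| inter: "N \<in> normal_gen G S \<Longrightarrow> H \<in> normal_gen G S \<Longrightarrow> N \<inter> H \<in> normal_gen G S"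

text \<open>In the usual notation, with \<open>A(S)\<close> for \<open>normal_gen G S\<close>: \<open>circ_part G S N\<close> is
  \<open>N\<^sup>\<circ>\<close>, \<open>irr_over G N\<close> is \<open>\<X>\<^sup>N\<close>, \<open>irr_bullet G S N\<close> is the set \<open>\<X>\<close> with exponent
  \<open>N\<^sup>\<bullet>\<close>, and \<open>char_bullet G S N\<close> is \<open>\<chi>\<close> with exponent \<open>N\<^sup>\<bullet>\<close>.\<close>

definition circ_part :: "('a, 'b) monoid_scheme \<Rightarrow> 'a set set \<Rightarrow> 'a set \<Rightarrow> 'a set" where
  "circ_part G S N = N - \<Union> {H \<in> normal_gen G S. H \<subset> N}"

definition irr_over :: "('a, 'b) monoid_scheme \<Rightarrow> 'a set \<Rightarrow> ('a \<Rightarrow> complex) set" where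
  "irr_over G N = {\<psi> \<in> Irr G. N \<subseteq> char_ker G \<psi>}"

definition irr_bullet ::
  "('a, 'b) monoid_scheme \<Rightarrow> 'a set set \<Rightarrow> 'a set \<Rightarrow> ('a \<Rightarrow> complex) set" where
  "irr_bullet G S N = irr_over G N - (\<Union>K\<in>{K \<in> normal_gen G S. N \<subset> K}. irr_over G K)"

definition char_bullet :: "('a, 'b) monoid_scheme \<Rightarrow> 'a set set \<Rightarrow> 'a set \<Rightarrow> 'a \<Rightarrow> complex" where
  "char_bullet G S N = weighted_sum G (irr_bullet G S N)"

section \<open>The Moebius function of a finite poset\<close>

text \<open>Outside the pairs \<open>s \<le> u\<close> in \<open>P\<close>, and for infinite \<open>P\<close>, the value is the junk value \<open>0\<close>.
  The recursion solves \<open>(\<Sum>t\<in>P with s \<le> t \<le> u. \<mu>(t,u)) = 0\<close> for the term \<open>t = s\<close>.\<close>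

function moebius :: "'c::order set \<Rightarrow> 'c \<Rightarrow> 'c \<Rightarrow> int" where
  "moebius P s u =
     (if finite P \<and> s \<in> P \<and> u \<in> P \<and> s \<le> u
      then if s = u then 1 else - (\<Sum>t\<in>{t \<in> P. s < t \<and> t \<le> u}. moebius P t u)
      else 0)"
  by auto
termination
proof (relation "measure (\<lambda>(P, s, u). card {t \<in> P. s < t})", goal_cases)
  case 1
  then show ?case by simp
next
  case (2 P s u t)
  then have "{x \<in> P. t < x} \<subset> {x \<in> P. s < x}" by force
  with 2 show ?case by (auto intro!: psubset_card_mono)
qed

declare moebius.simps [simp del]

lemma moebius_refl: "finite P \<Longrightarrow> s \<in> P \<Longrightarrow> moebius P s s = 1"
  by (simp add: moebius.simps)

lemma moebius_sum_eq_0: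
  assumes "finite P" "s \<in> P" "u \<in> P" "s < u"
  shows "(\<Sum>t\<in>{t \<in> P. s \<le> t \<and> t \<le> u}. moebius P t u) = 0"
proof -
  have "{t \<in> P. s \<le> t \<and> t \<le> u} = insert s {t \<in> P. s < t \<and> t \<le> u}"
    using assms by auto
  moreover have "moebius P s u = - (\<Sum>t\<in>{t \<in> P. s < t \<and> t \<le> u}. moebius P t u)"
    using assms by (subst moebius.simps) auto
  ultimately show ?thesis using assms by simp
qed

end

theory Submission
  imports
    Defs
    "HOL-Algebra.Zassenhaus"
    "HOL-Library.Function_Algebras"
    "Jordan_Normal_Form.DL_Rank"
    "Jordan_Normal_Form.Spectral_Radius"
begin

text \<open>For a normal subgroup \<open>N\<close>, averaging the regular character
  \<open>\<Sum>\<psi>(1)\<psi>\<close> over \<open>N\<close> kills every irreducible \<open>\<psi>\<close> that is not trivial on \<open>N\<close>, so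
  \<open>\<chi>\<^sup>N = |G|/|N| \<cdot> 1\<^sub>N\<close>, where \<open>\<chi>\<^sup>N\<close> is the sum of \<open>\<psi>(1)\<psi>\<close> over the \<open>\<psi>\<close> whose kernel contains \<open>N\<close>.
  As \<open>A(S)\<close> is closed under products, each \<open>\<psi>\<close> has a largest member of \<open>A(S)\<close> in its kernel, so
  \<open>\<chi>\<^sup>N\<close> is the sum of the bullet characters over all \<open>M \<supseteq> N\<close>, and Moebius inversion gives the formula.
  Closure under intersections gives each \<open>g\<close> a smallest member of \<open>A(S)\<close> containing it. The nonzero bullet
  characters and the indicators of the nonempty \<open>N\<^sup>\<circ>\<close> are two linearly independent families that both span
  the indicators of the members of \<open>A(S)\<close>; hence they have the same size.

  The regular character is decomposed without Maschke's theorem: block triangularisation shows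
  that every character is a sum of irreducible ones, and orthogonality yields the
  multiplicities.\<close>

section \<open>Linear algebra\<close>

context vec_space begin

text \<open>Independent sets in an \<open>n\<close>-dimensional space have at most \<open>n\<close>
  elements, so one between \<open>U\<close> and \<open>W\<close> can be chosen maximal. A vector of
  \<open>W\<close> outside its span could still be added.\<close>

lemma lin_indpt_extends:
  assumes "U \<subseteq> carrier_vec n" "lin_indpt U" "W \<subseteq> carrier_vec n" "U \<subseteq> W"
  obtains B where "finite B" "U \<subseteq> B" "B \<subseteq> W" "lin_indpt B" "W \<subseteq> span B"
proof -
  let ?P = "\<lambda>B. U \<subseteq> B \<and> B \<subseteq> W \<and> lin_indpt B"
  have bound: "finite B \<and> card B \<le> n" if "?P B" for B
    using that assms li_le_dim[of B] dim_is_n by auto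
  obtain B where B: "finite B" "maximal B ?P"
    using maximal_exists[of ?P n U] bound assms by auto
  have mx: "\<forall>C. B \<subseteq> C \<and> ?P C \<longrightarrow> C = B"
    using B(2) unfolding maximal_def by (rule conjunct2)
  have PB: "?P B" using B(2) unfolding maximal_def by auto
  have "w \<in> span B" if w: "w \<in> W" for w
  proof (rule ccontr)
    assume nin: "w \<notin> span B"
    have Bc: "B \<subseteq> carrier_vec n" using PB assms by auto
    have wB: "w \<notin> B" using nin span_mem[OF Bc] by auto
    have "lin_indpt (B \<union> {w})"
    proof
      assume "lin_dep (B \<union> {w})"
      moreover have "w \<in> carrier_vec n" "B \<subseteq> carrier_vec n" using w assms(3) Bc by auto
      moreover have "lin_indpt B" using PB by blast
      ultimately show False using lin_dep_iff_in_span[of B w] wB nin by blast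
    qed
    then have "?P (B \<union> {w})" using PB w by auto
    then have "B \<union> {w} = B" using mx[rule_format, of "B \<union> {w}"] by blast
    then show False using wB by blast
  qed
  then have "W \<subseteq> span B" by blast
  then show thesis using that[OF B(1)] PB by blast
qed

text \<open>A basis of \<open>W\<close>, extended to the whole space, supplies the columns of
  \<open>P\<close>. In these coordinates \<open>W\<close> consists of the vectors supported on the
  first \<open>k\<close> positions, the form in which invariance becomes a block of zeros.\<close>

lemma subspace_adapted_basis:
  assumes W: "VectorSpace.subspace class_ring W V"
  obtains P Q k where "P \<in> carrier_mat n n" "Q \<in> carrier_mat n n" "P * Q = 1\<^sub>m n" "Q * P = 1\<^sub>m n" "k \<le> n"
    "W = {P *\<^sub>v x |x. x \<in> carrier_vec n \<and> (\<forall>i. k \<le> i \<longrightarrow> i < n \<longrightarrow> x $ i = 0)}"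
proof -
  have sub: "submodule class_ring W V" using W unfolding VectorSpace.subspace_def by auto
  have Wc: "W \<subseteq> carrier_vec n" using sub unfolding submodule_def by auto
  obtain U where U: "finite U" "U \<subseteq> W" "lin_indpt U" "W \<subseteq> span U"
  proof -
    have "lin_indpt {}" by (simp add: lin_dep_def)
    then show thesis using lin_indpt_extends[of "{}" W thesis] Wc that by blast
  qed
  have Uc: "U \<subseteq> carrier_vec n" using U Wc by auto
  obtain B where B: "finite B" "U \<subseteq> B" "B \<subseteq> carrier_vec n" "lin_indpt B" "carrier_vec n \<subseteq> span B"
    using lin_indpt_extends[OF Uc U(3) subset_refl Uc] .
  have bB: "basis B" unfolding basis_def using B span_is_subset2[of B] by (simp add: subset_antisym)
  have cB: "card B = n" using dim_basis[OF B(1) bB] dim_is_n by simp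
  obtain us where us: "set us = U" "distinct us" using finite_distinct_list[OF U(1)] by auto
  have dus: "\<forall>w\<in>set us. dim_vec w = n" using us(1) Uc carrier_vecD by blast
  obtain ws where ws: "set ws = B - U" "distinct ws" using finite_distinct_list[of "B - U"] B(1) by auto
  define bs where "bs = us @ ws"
  have bs: "set bs = B" "distinct bs" unfolding bs_def using us ws B(2) by auto
  have lbs: "length bs = n" using bs cB distinct_card by metis
  define P where "P = mat_of_cols n bs"
  have Pc: "P \<in> carrier_mat n n" unfolding P_def using lbs by auto
  have cols: "cols P = bs" unfolding P_def using bs B(3) by (intro cols_mat_of_cols) auto
  have "rank P = n" using lin_indpt_full_rank[OF Pc] cols bs B(4) by auto
  then have "det P \<noteq> 0" using det_rank_iff[OF Pc] by auto
  then have "P \<in> Units (ring_mat TYPE('a) n ())" by (rule det_non_zero_imp_unit[OF Pc])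
  then obtain Q where Q: "Q \<in> carrier_mat n n" "P * Q = 1\<^sub>m n" "Q * P = 1\<^sub>m n"
    unfolding Units_def ring_mat_def by auto
  let ?k = "length us"
  have kn: "?k \<le> n" using lbs bs_def by auto
  \<comment> \<open>The first \<open>?k\<close> columns of \<open>P\<close> are \<open>us\<close>,
    so on vectors supported there \<open>P\<close> acts as the matrix with columns
    \<open>us\<close>.\<close>
  have Pmult: "P *\<^sub>v x = mat_of_cols n us *\<^sub>v vec ?k (\<lambda>i. x $ i)"
    if x: "x \<in> carrier_vec n" "\<forall>i. ?k \<le> i \<longrightarrow> i < n \<longrightarrow> x $ i = 0" for x
  proof (rule eq_vecI)
    fix r assume "r < dim_vec (mat_of_cols n us *\<^sub>v vec ?k (\<lambda>i. x $ i))"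
    then have r: "r < n" by auto
    have "(P *\<^sub>v x) $ r = (\<Sum>i<n. bs ! i $ r * x $ i)"
      using r x lbs by (auto simp: P_def scalar_prod_def mat_of_cols_def atLeast0LessThan)
    also have "\<dots> = (\<Sum>i<?k. bs ! i $ r * x $ i)"
      using x(2) kn by (intro sum.mono_neutral_right) auto
    also have "\<dots> = (mat_of_cols n us *\<^sub>v vec ?k (\<lambda>i. x $ i)) $ r"
      using r by (auto simp: bs_def scalar_prod_def mat_of_cols_def atLeast0LessThan nth_append)
    finally show "(P *\<^sub>v x) $ r = (mat_of_cols n us *\<^sub>v vec ?k (\<lambda>i. x $ i)) $ r" .
  qed (use Pc in auto)
  have "W = {P *\<^sub>v x |x. x \<in> carrier_vec n \<and> (\<forall>i. ?k \<le> i \<longrightarrow> i < n \<longrightarrow> x $ i = 0)}" (is "_ = ?R")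
  proof (intro equalityI subsetI)
    fix w assume "w \<in> W"
    then have "w \<in> span_list us" using U(4) us(1) Uc span_list_as_span[of us] by blast
    then obtain c where "w = lincomb_list c us" by (rule in_span_listE)
    then have w: "w = mat_of_cols n us *\<^sub>v vec ?k c"
      using lincomb_list_as_mat_mult[OF dus] by auto
    define x where "x = vec n (\<lambda>i. if i < ?k then c i else 0)"
    have "vec ?k (\<lambda>i. x $ i) = vec ?k c" using kn by (auto simp: x_def)
    then have "w = P *\<^sub>v x" using Pmult[of x] w by (auto simp: x_def)
    then show "w \<in> ?R" by (auto simp: x_def)
  next
    fix w assume "w \<in> ?R"
    then obtain x where x: "w = P *\<^sub>v x" "x \<in> carrier_vec n" "\<forall>i. ?k \<le> i \<longrightarrow> i < n \<longrightarrow> x $ i = 0" by auto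
    have "w = lincomb_list (\<lambda>i. x $ i) us"
      using Pmult[OF x(2,3)] x(1) lincomb_list_as_mat_mult[OF dus] by auto
    then have "w \<in> span_list us" unfolding span_list_def by blast
    then have "w \<in> span U" using span_list_as_span[of us] us(1) Uc by simp
    then show "w \<in> W" using span_is_subset[OF U(2) sub] by blast
  qed
  then show thesis using that Pc Q kn by blast
qed

end

lemma mat_eq_by_vec:
  fixes A B :: "'a :: semiring_1 mat"
  assumes "A \<in> carrier_mat n m" "B \<in> carrier_mat n m" "\<And>v. v \<in> carrier_vec m \<Longrightarrow> A *\<^sub>v v = B *\<^sub>v v"
  shows "A = B"
proof (rule eq_matI)
  fix i j assume ij: "i < dim_row B" "j < dim_col B"
  have "(A *\<^sub>v unit_vec m j) $ i = (B *\<^sub>v unit_vec m j) $ i" using assms(3)[of "unit_vec m j"] by simp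
  then show "A $$ (i,j) = B $$ (i,j)" using ij assms(1,2) by auto
qed (use assms in auto)

lemma trace_mult_comm:
  fixes A B :: "'a :: comm_semiring_0 mat"
  assumes "A \<in> carrier_mat n m" "B \<in> carrier_mat m n"
  shows "(\<Sum>i<n. (A * B) $$ (i,i)) = (\<Sum>j<m. (B * A) $$ (j,j))"
proof -
  have "(\<Sum>i<n. (A * B) $$ (i,i)) = (\<Sum>i<n. \<Sum>j<m. A $$ (i,j) * B $$ (j,i))"
    using assms by (auto simp: scalar_prod_def atLeast0LessThan intro!: sum.cong)
  also have "\<dots> = (\<Sum>j<m. \<Sum>i<n. B $$ (j,i) * A $$ (i,j))"
    by (subst sum.swap) (simp add: mult.commute)
  also have "\<dots> = (\<Sum>j<m. (B * A) $$ (j,j))"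
    using assms by (auto simp: scalar_prod_def atLeast0LessThan intro!: sum.cong)
  finally show ?thesis .
qed

lemma mult_mat_index:
  assumes "A \<in> carrier_mat n k" "B \<in> carrier_mat k m" "i < n" "j < m"
  shows "(A * B) $$ (i,j) = (\<Sum>l<k. A $$ (i,l) * B $$ (l,j))"
  using assms by (auto simp: scalar_prod_def atLeast0LessThan)

lemma mult_mat_zero_vec:
  fixes A :: "'a :: semiring_1 mat"
  shows "A \<in> carrier_mat n m \<Longrightarrow> A *\<^sub>v 0\<^sub>v m = 0\<^sub>v n"
  by (rule eq_vecI) auto

section \<open>Function spaces and a criterion for linear independence\<close>

lemma sum_fun_apply:
  fixes f :: "'i \<Rightarrow> 'c \<Rightarrow> 'd :: comm_monoid_add"
  shows "(\<Sum>i\<in>I. f i) x = (\<Sum>i\<in>I. f i x)"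
  by (induction I rule: infinite_finite_induct) auto

interpretation fun_space: vector_space "\<lambda>(c :: 'f :: field) (f :: 'x \<Rightarrow> 'f) x. c * f x"
  by unfold_locales (auto simp: fun_eq_iff algebra_simps)

text \<open>The kernel of a functional \<open>L\<close> separating \<open>f\<close> is a subspace
  that contains the other members of \<open>B\<close>, hence their span, but not \<open>f\<close>.
  The functionals used below are the pairing with an irreducible character and evaluation at a
  point.\<close>

lemma independent_if_separated:
  fixes B :: "('x \<Rightarrow> 'f :: field) set"
  assumes L: "\<And>f. f \<in> B \<Longrightarrow> \<exists>L :: ('x \<Rightarrow> 'f) \<Rightarrow> 'f. (\<forall>f h. L (f + h) = L f + L h) \<and>
    (\<forall>c f. L (\<lambda>x. c * f x) = c * L f) \<and> L f \<noteq> 0 \<and> (\<forall>h\<in>B - {f}. L h = 0)"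
  shows "fun_space.independent B"
proof
  assume "fun_space.dependent B"
  then obtain f where f: "f \<in> B" "f \<in> fun_space.span (B - {f})" unfolding fun_space.dependent_def by blast
  obtain L :: "('x \<Rightarrow> 'f) \<Rightarrow> 'f" where L: "\<And>f h. L (f + h) = L f + L h" "\<And>c f. L (\<lambda>x. c * f x) = c * L f"
     "L f \<noteq> 0" "\<forall>h\<in>B - {f}. L h = 0" using L[OF f(1)] by metis
  have "L 0 = 0" using L(2)[of 0 0] by (simp add: zero_fun_def)
  then have "fun_space.subspace {h. L h = 0}" by (intro fun_space.subspaceI) (auto simp: L(1,2))
  moreover have "B - {f} \<subseteq> {h. L h = 0}" using L(4) by blast
  ultimately have "fun_space.span (B - {f}) \<subseteq> {h. L h = 0}" by (intro fun_space.span_minimal)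
  then show False using f(2) L(3) by blast
qed

section \<open>Representations and Schur's lemma\<close>

lemma subspace_vec_iff:
  "VectorSpace.subspace class_ring W (module_vec TYPE('a::field) n) \<longleftrightarrow>
     W \<subseteq> carrier_vec n \<and> 0\<^sub>v n \<in> W \<and> (\<forall>v\<in>W. \<forall>w\<in>W. v + w \<in> W) \<and> (\<forall>c. \<forall>v\<in>W. c \<cdot>\<^sub>v v \<in> W)"
proof -
  interpret vec_space "TYPE('a)" n .
  have "Module.module class_ring V" by (rule vec_module)
  moreover have "vectorspace class_ring V" by (rule vec_vs)
  ultimately show ?thesis
    unfolding VectorSpace.subspace_def LinearCombinations.submodule_def
    by (auto simp: module_vec_simps)
qed

lemma invariant_subspace_iff:
  "invariant_subspace G n \<rho> W \<longleftrightarrow>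
     W \<subseteq> carrier_vec n \<and> 0\<^sub>v n \<in> W \<and> (\<forall>v\<in>W. \<forall>w\<in>W. v + w \<in> W) \<and> (\<forall>c. \<forall>v\<in>W. c \<cdot>\<^sub>v v \<in> W) \<and>
     (\<forall>g\<in>carrier G. \<forall>w\<in>W. \<rho> g *\<^sub>v w \<in> W)"
  unfolding invariant_subspace_def subspace_vec_iff by blast

context group begin

text \<open>Invertibility is automatic: \<open>\<rho> (inv g)\<close> inverts
  \<open>\<rho> g\<close>. Later constructions of representations therefore exhibit no
  inverses.\<close>

lemma is_rep_iff:
  "is_rep G n \<rho> \<longleftrightarrow> (\<forall>g\<in>carrier G. \<rho> g \<in> carrier_mat n n) \<and>
     (\<forall>g\<in>carrier G. \<forall>h\<in>carrier G. \<rho> (g \<otimes> h) = \<rho> g * \<rho> h) \<and> \<rho> \<one> = 1\<^sub>m n"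
proof -
  let ?M = "ring_mat TYPE(complex) n ()"
  interpret M: ring ?M by (rule ring_mat)
  interpret U: group "GL n" unfolding GL_def by (rule M.units_group)
  have simps: "carrier (GL n) = Units ?M" "\<And>x y. x \<otimes>\<^bsub>GL n\<^esub> y = x * y" "\<one>\<^bsub>GL n\<^esub> = 1\<^sub>m n"
    "Units ?M \<subseteq> carrier_mat n n"
    by (auto simp: GL_def units_of_def ring_mat_def Units_def)
  show ?thesis
  proof
    assume rep: "is_rep G n \<rho>"
    then interpret H: group_hom G "GL n" \<rho>
      unfolding is_rep_def by unfold_locales
    show "(\<forall>g\<in>carrier G. \<rho> g \<in> carrier_mat n n) \<and>
     (\<forall>g\<in>carrier G. \<forall>h\<in>carrier G. \<rho> (g \<otimes> h) = \<rho> g * \<rho> h) \<and> \<rho> \<one> = 1\<^sub>m n"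
      using H.hom_closed H.hom_mult H.hom_one simps by auto
  next
    assume r: "(\<forall>g\<in>carrier G. \<rho> g \<in> carrier_mat n n) \<and>
     (\<forall>g\<in>carrier G. \<forall>h\<in>carrier G. \<rho> (g \<otimes> h) = \<rho> g * \<rho> h) \<and> \<rho> \<one> = 1\<^sub>m n"
    have "\<rho> g \<in> Units ?M" if g: "g \<in> carrier G" for g
    proof -
      have "\<rho> g * \<rho> (inv g) = 1\<^sub>m n" "\<rho> (inv g) * \<rho> g = 1\<^sub>m n"
        using r g by (metis inv_closed r_inv l_inv)+
      then show ?thesis using r g inv_closed[OF g]
        by (auto simp: Units_def ring_mat_def intro!: bexI[of _ "\<rho> (inv g)"])
    qed
    then show "is_rep G n \<rho>" unfolding is_rep_def hom_def using simps r by auto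
  qed
qed

lemma is_repD:
  assumes "is_rep G n \<rho>"
  shows "g \<in> carrier G \<Longrightarrow> \<rho> g \<in> carrier_mat n n"
    "g \<in> carrier G \<Longrightarrow> h \<in> carrier G \<Longrightarrow> \<rho> (g \<otimes> h) = \<rho> g * \<rho> h" "\<rho> \<one> = 1\<^sub>m n"
  using assms is_rep_iff by auto

lemma irreducible_repD:
  assumes "irreducible_rep G n \<rho>"
  shows "is_rep G n \<rho>" "0 < n" "invariant_subspace G n \<rho> W \<Longrightarrow> W \<noteq> {0\<^sub>v n} \<Longrightarrow> W = carrier_vec n"
  using assms unfolding irreducible_rep_def by auto

lemma rep_character_one: "is_rep G n \<rho> \<Longrightarrow> rep_character G n \<rho> \<one> = of_nat n"
  using is_repD(3)[of n \<rho>] by (simp add: rep_character_def)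

text \<open>\<open>\<rho> g\<close> equals \<open>T * \<sigma> g * S\<close>, and the trace is
  invariant under cyclic permutation of factors. The sizes \<open>n\<close> and \<open>m\<close> are
  kept separate so that Schur's lemma need not compare degrees first.\<close>

lemma rep_character_similar:
  assumes \<rho>: "is_rep G n \<rho>" and \<sigma>: "is_rep G m \<sigma>"
    and T: "T \<in> carrier_mat n m" "S \<in> carrier_mat m n" "T * S = 1\<^sub>m n" "S * T = 1\<^sub>m m"
    and int: "\<And>g. g \<in> carrier G \<Longrightarrow> \<rho> g * T = T * \<sigma> g"
  shows "rep_character G n \<rho> = rep_character G m \<sigma>"
proof
  fix g
  show "rep_character G n \<rho> g = rep_character G m \<sigma> g"
  proof (cases "g \<in> carrier G")
    case g: True
    note r = is_repD(1)[OF \<rho> g] and s = is_repD(1)[OF \<sigma> g]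
    have "\<rho> g = \<rho> g * (T * S)" using r T by simp
    also have "\<dots> = \<rho> g * T * S" using assoc_mult_mat[OF r T(1,2)] by simp
    also have "\<dots> = T * (\<sigma> g * S)" using assoc_mult_mat[OF T(1) s T(2)] int[OF g] by simp
    finally have "(\<Sum>i<n. \<rho> g $$ (i,i)) = (\<Sum>i<n. (T * (\<sigma> g * S)) $$ (i,i))" by simp
    also have "\<dots> = (\<Sum>i<m. ((\<sigma> g * S) * T) $$ (i,i))" using s T by (intro trace_mult_comm) auto
    also have "(\<sigma> g * S) * T = \<sigma> g" using assoc_mult_mat[OF s T(2,1)] s T(4) by simp
    finally show ?thesis using g by (simp add: rep_character_def)
  qed (simp add: rep_character_def)
qed

text \<open>Kernel and image of an intertwiner are invariant. As \<open>T\<close> is nonzero,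
  irreducibility of \<open>\<sigma>\<close> makes the kernel zero and irreducibility of
  \<open>\<rho>\<close> makes the image everything, so \<open>T\<close> is invertible.\<close>

lemma schur_iso:
  assumes \<rho>: "irreducible_rep G n \<rho>" and \<sigma>: "irreducible_rep G m \<sigma>"
    and T: "T \<in> carrier_mat n m" "T \<noteq> 0\<^sub>m n m"
    and int: "\<And>g. g \<in> carrier G \<Longrightarrow> \<rho> g * T = T * \<sigma> g"
  shows "rep_character G n \<rho> = rep_character G m \<sigma>"
proof -
  note r = is_repD[OF irreducible_repD(1)[OF \<rho>]] and s = is_repD[OF irreducible_repD(1)[OF \<sigma>]]
  have intv: "\<rho> g *\<^sub>v (T *\<^sub>v v) = T *\<^sub>v (\<sigma> g *\<^sub>v v)" if "g \<in> carrier G" "v \<in> carrier_vec m" for g v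
    using int[OF that(1)] that r(1)[OF that(1)] s(1)[OF that(1)] T(1)
    by (metis assoc_mult_mat_vec)
  let ?K = "{v \<in> carrier_vec m. T *\<^sub>v v = 0\<^sub>v n}"
  let ?I = "{T *\<^sub>v v |v. v \<in> carrier_vec m}"
  have "invariant_subspace G m \<sigma> ?K"
    unfolding invariant_subspace_iff
  proof (intro conjI ballI allI)
    fix g w assume g: "g \<in> carrier G" and w: "w \<in> ?K"
    have "T *\<^sub>v (\<sigma> g *\<^sub>v w) = 0\<^sub>v n" using intv[OF g, of w] w mult_mat_zero_vec[OF r(1)[OF g]] by auto
    then show "\<sigma> g *\<^sub>v w \<in> ?K" using s(1)[OF g] w by auto
  qed (use T in \<open>auto simp: mult_add_distrib_mat_vec mult_mat_vec\<close>)
  moreover have "?K \<noteq> carrier_vec m"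
  proof
    assume K: "?K = carrier_vec m"
    have "T = 0\<^sub>m n m"
    proof (rule mat_eq_by_vec[OF T(1)])
      fix v :: "complex vec" assume v: "v \<in> carrier_vec m"
      then have "T *\<^sub>v v = 0\<^sub>v n" using K by blast
      then show "T *\<^sub>v v = 0\<^sub>m n m *\<^sub>v v" using v by (auto intro!: eq_vecI)
    qed simp
    then show False using T by simp
  qed
  ultimately have K: "?K = {0\<^sub>v m}" using irreducible_repD(3)[OF \<sigma>] by blast
  have "invariant_subspace G n \<rho> ?I"
    unfolding invariant_subspace_iff
  proof (intro conjI ballI allI)
    show "0\<^sub>v n \<in> ?I" using T by (auto intro!: exI[of _ "0\<^sub>v m"])
  next
    fix v w assume "v \<in> ?I" "w \<in> ?I"
    then show "v + w \<in> ?I" using T by clarsimp (metis add_carrier_vec mult_add_distrib_mat_vec)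
  next
    fix c v assume "v \<in> ?I"
    then show "c \<cdot>\<^sub>v v \<in> ?I" using T by clarsimp (metis smult_carrier_vec mult_mat_vec)
  next
    fix g v assume g: "g \<in> carrier G" and "v \<in> ?I"
    then show "\<rho> g *\<^sub>v v \<in> ?I" using intv[OF g] s(1)[OF g] by clarsimp (metis mult_mat_vec_carrier)
  qed (use T in auto)
  moreover have "?I \<noteq> {0\<^sub>v n}"
  proof
    assume I: "?I = {0\<^sub>v n}"
    have "T = 0\<^sub>m n m"
    proof (rule mat_eq_by_vec[OF T(1)])
      fix v :: "complex vec" assume v: "v \<in> carrier_vec m"
      then have "T *\<^sub>v v = 0\<^sub>v n" using I by blast
      then show "T *\<^sub>v v = 0\<^sub>m n m *\<^sub>v v" using v by (auto intro!: eq_vecI)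
    qed simp
    then show False using T by simp
  qed
  ultimately have I: "?I = carrier_vec n" using irreducible_repD(3)[OF \<rho>] by blast
  \<comment> \<open>Preimages of the unit vectors under the surjective \<open>T\<close> become the
    columns of a right inverse \<open>S\<close>.\<close>
  have "\<forall>i. \<exists>v \<in> carrier_vec m. T *\<^sub>v v = unit_vec n i"
  proof
    fix i
    have "unit_vec n i \<in> ?I" unfolding I by simp
    then show "\<exists>v \<in> carrier_vec m. T *\<^sub>v v = unit_vec n i" by force
  qed
  then obtain f where f: "\<And>i. f i \<in> carrier_vec m" "\<And>i. T *\<^sub>v f i = unit_vec n i" by metis
  define S where "S = mat_of_cols m (map f [0..<n])"
  have S: "S \<in> carrier_mat m n" unfolding S_def by auto
  have colS: "col S j = f j" if "j < n" for j
    unfolding S_def using that f(1) by (subst col_mat_of_cols) auto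
  have TS: "T * S = 1\<^sub>m n"
  proof (rule eq_matI)
    fix i j assume ij: "i < dim_row (1\<^sub>m n)" "j < dim_col (1\<^sub>m n)"
    then have "(T * S) $$ (i,j) = (T *\<^sub>v f j) $ i" using T S colS by auto
    then show "(T * S) $$ (i,j) = 1\<^sub>m n $$ (i,j)" using f(2) ij by (simp add: unit_vec_def)
  qed (use T S in auto)
  \<comment> \<open>\<open>S\<close> is also a left inverse: \<open>T\<close> maps
    \<open>S T v\<close> and \<open>v\<close> to the same vector, and its kernel is zero.\<close>
  have "S * T = 1\<^sub>m m"
  proof (rule mat_eq_by_vec)
    fix v :: "complex vec" assume v: "v \<in> carrier_vec m"
    have Tv: "T *\<^sub>v v \<in> carrier_vec n" and STv: "(S * T) *\<^sub>v v \<in> carrier_vec m" using T S v by auto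
    have "T *\<^sub>v ((S * T) *\<^sub>v v) = (T * S) *\<^sub>v (T *\<^sub>v v)"
      using assoc_mult_mat_vec[OF S T(1) v] assoc_mult_mat_vec[OF T(1) S Tv] by simp
    then have "T *\<^sub>v ((S * T) *\<^sub>v v) = T *\<^sub>v v" using TS Tv by simp
    then have "T *\<^sub>v ((S * T) *\<^sub>v v - v) = 0\<^sub>v n"
      using T v STv Tv by (simp add: mult_minus_distrib_mat_vec)
    then have "(S * T) *\<^sub>v v - v \<in> ?K" using v STv by auto
    then have d: "(S * T) *\<^sub>v v - v = 0\<^sub>v m" using K by auto
    show "(S * T) *\<^sub>v v = 1\<^sub>m m *\<^sub>v v"
    proof (rule eq_vecI)
      fix i assume "i < dim_vec (1\<^sub>m m *\<^sub>v v)"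
      then have i: "i < m" by simp
      have "((S * T) *\<^sub>v v - v) $ i = ((S * T) *\<^sub>v v) $ i - v $ i" using i v by (intro index_minus_vec) auto
      then show "((S * T) *\<^sub>v v) $ i = (1\<^sub>m m *\<^sub>v v) $ i" using d i v by simp
    qed (use S in auto)
  qed (use T S in auto)
  then show ?thesis
    using rep_character_similar[OF irreducible_repD(1)[OF \<rho>] irreducible_repD(1)[OF \<sigma>] T(1) S TS _ int] by simp
qed

text \<open>Over the complex numbers \<open>T\<close> has an eigenvalue, since \<open>n\<close> is
  positive. The eigenspace is invariant and nonzero, hence the whole space.\<close>

lemma schur_scalar:
  assumes \<rho>: "irreducible_rep G n \<rho>" and T: "T \<in> carrier_mat n n"
    and int: "\<And>g. g \<in> carrier G \<Longrightarrow> \<rho> g * T = T * \<rho> g"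
  obtains c where "T = c \<cdot>\<^sub>m 1\<^sub>m n"
proof -
  note r = is_repD[OF irreducible_repD(1)[OF \<rho>]]
  obtain c where "eigenvalue T c"
    using spectrum_non_empty[OF T irreducible_repD(2)[OF \<rho>]] unfolding spectrum_def by auto
  then obtain v where v: "v \<in> carrier_vec n" "v \<noteq> 0\<^sub>v n" "T *\<^sub>v v = c \<cdot>\<^sub>v v"
    unfolding eigenvalue_def eigenvector_def using T by auto
  let ?E = "{v \<in> carrier_vec n. T *\<^sub>v v = c \<cdot>\<^sub>v v}"
  have "invariant_subspace G n \<rho> ?E"
    unfolding invariant_subspace_iff
  proof (intro conjI ballI allI)
    fix g w assume g: "g \<in> carrier G" and w: "w \<in> ?E"
    have "T *\<^sub>v (\<rho> g *\<^sub>v w) = \<rho> g *\<^sub>v (T *\<^sub>v w)" using w T r(1)[OF g] int[OF g]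
      by (metis (no_types, lifting) assoc_mult_mat_vec mem_Collect_eq)
    also have "\<dots> = c \<cdot>\<^sub>v (\<rho> g *\<^sub>v w)" using w r(1)[OF g] by (auto simp: mult_mat_vec)
    finally show "\<rho> g *\<^sub>v w \<in> ?E" using r(1)[OF g] w by auto
  qed (use T in \<open>auto simp: mult_add_distrib_mat_vec mult_mat_vec smult_add_distrib_vec smult_smult_assoc mult.commute\<close>)
  moreover have "?E \<noteq> {0\<^sub>v n}" using v by auto
  ultimately have E: "?E = carrier_vec n" using irreducible_repD(3)[OF \<rho>] by blast
  have "T = c \<cdot>\<^sub>m 1\<^sub>m n"
  proof (rule mat_eq_by_vec[OF T])
    fix w :: "complex vec" assume w: "w \<in> carrier_vec n"
    then have "T *\<^sub>v w = c \<cdot>\<^sub>v w" using E by blast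
    then show "T *\<^sub>v w = (c \<cdot>\<^sub>m 1\<^sub>m n) *\<^sub>v w" using w by (auto intro!: eq_vecI)
  qed simp
  then show thesis by (rule that)
qed

end

section \<open>Orthogonality and the regular character\<close>

lemma sum_mset_eq_sum_count:
  fixes f :: "'c \<Rightarrow> 'd :: comm_semiring_1"
  shows "(\<Sum>x\<in>#M. f x) = (\<Sum>x\<in>set_mset M. of_nat (count M x) * f x)"
proof (induction M)
  case (add y M)
  have "(\<Sum>x\<in>insert y (set_mset M). of_nat (count M x) * f x) = (\<Sum>x\<in>set_mset M. of_nat (count M x) * f x)"
    by (rule sum.mono_neutral_right) (auto simp: not_in_iff)
  moreover have "(\<Sum>x\<in>insert y (set_mset M). of_nat (count (add_mset y M) x) * f x)
     = (\<Sum>x\<in>insert y (set_mset M). of_nat (count M x) * f x + (if x = y then f y else 0))"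
    by (intro sum.cong) (auto simp: algebra_simps)
  ultimately show ?case using add by (simp add: sum.distrib add.commute)
qed simp

lemma sum_split_lessThan:
  fixes f :: "nat \<Rightarrow> 'a :: comm_monoid_add"
  assumes "k \<le> n"
  shows "(\<Sum>i<n. f i) = (\<Sum>i<k. f i) + (\<Sum>i<n - k. f (i + k))"
proof -
  obtain d where "n = k + d" using assms le_Suc_ex by blast
  moreover have "(\<Sum>i<k + d. f i) = (\<Sum>i<k. f i) + (\<Sum>i<d. f (i + k))"
    by (induction d) (auto simp: ac_simps)
  ultimately show ?thesis by simp
qed

context group begin

text \<open>The inner product of characters without the factor 1/|G|. Writing \<open>inv g\<close>
  in place of complex conjugation keeps the pairing bilinear and lets orthogonality follow from
  Schur's lemma without unitarity.\<close>

definition char_pairing :: "('a \<Rightarrow> complex) \<Rightarrow> ('a \<Rightarrow> complex) \<Rightarrow> complex" where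
  "char_pairing \<phi> \<psi> = (\<Sum>g\<in>carrier G. \<phi> g * \<psi> (inv g))"

lemma sum_translate:
  assumes "h \<in> carrier G"
  shows "(\<Sum>g\<in>carrier G. f (h \<otimes> g)) = sum f (carrier G)"
  by (rule sum.reindex_bij_witness[of _ "\<lambda>g. inv h \<otimes> g" "\<lambda>g. h \<otimes> g"])
     (use assms in \<open>auto simp: m_assoc[symmetric]\<close>)

lemma rep_mult_index:
  assumes "is_rep G n \<rho>" "g \<in> carrier G" "h \<in> carrier G" "i < n" "j < n"
  shows "\<rho> (g \<otimes> h) $$ (i,j) = (\<Sum>l<n. \<rho> g $$ (i,l) * \<rho> h $$ (l,j))"
  using mult_mat_index[OF is_repD(1)[OF assms(1,2)] is_repD(1)[OF assms(1,3)] assms(4,5)]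
    is_repD(2)[OF assms(1-3)] by simp

text \<open>\<open>T\<close> is the entrywise form of the sum over \<open>g\<close> of
  \<open>\<rho> g\<close> times the matrix unit at \<open>(j,k)\<close> times
  \<open>\<sigma> (inv g)\<close>. Replacing \<open>g\<close> by \<open>h \<otimes> g\<close> moves
  \<open>h\<close> from the left to the right.\<close>

lemma averaged_intertwiner:
  assumes \<rho>: "is_rep G n \<rho>" and \<sigma>: "is_rep G m \<sigma>" and jk: "j < n" "k < m" and h: "h \<in> carrier G"
  defines "T \<equiv> mat n m (\<lambda>(i,l). \<Sum>g\<in>carrier G. \<rho> g $$ (i,j) * \<sigma> (inv g) $$ (k,l))"
  shows "\<rho> h * T = T * \<sigma> h"
proof (rule eq_matI)
  note r = is_repD[OF \<rho>] and s = is_repD[OF \<sigma>]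
  have T: "T \<in> carrier_mat n m" by (simp add: T_def)
  fix i l assume "i < dim_row (T * \<sigma> h)" "l < dim_col (T * \<sigma> h)"
  then have i: "i < n" and l: "l < m" using T s(1)[OF h] by auto
  have "(\<rho> h * T) $$ (i,l) = (\<Sum>a<n. \<Sum>g\<in>carrier G. \<rho> h $$ (i,a) * \<rho> g $$ (a,j) * \<sigma> (inv g) $$ (k,l))"
    using mult_mat_index[OF r(1)[OF h] T i l] l by (simp add: T_def sum_distrib_left mult.assoc)
  also have "\<dots> = (\<Sum>g\<in>carrier G. \<rho> (h \<otimes> g) $$ (i,j) * \<sigma> (inv g) $$ (k,l))"
    by (subst sum.swap) (auto simp: rep_mult_index[OF \<rho> h _ i jk(1)] sum_distrib_right intro!: sum.cong)
  \<comment> \<open>Since \<open>inv g\<close> equals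
    \<open>inv (h \<otimes> g) \<otimes> h\<close>, the summand depends on \<open>g\<close> only
    through \<open>h \<otimes> g\<close>, as translation requires.\<close>
  also have "\<dots> = (\<Sum>g\<in>carrier G. \<rho> (h \<otimes> g) $$ (i,j) * \<sigma> (inv (h \<otimes> g) \<otimes> h) $$ (k,l))"
    using h by (intro sum.cong) (auto simp: inv_mult_group m_assoc)
  also have "\<dots> = (\<Sum>g\<in>carrier G. \<rho> g $$ (i,j) * \<sigma> (inv g \<otimes> h) $$ (k,l))"
    by (rule sum_translate[OF h])
  also have "\<dots> = (\<Sum>b<m. \<Sum>g\<in>carrier G. \<rho> g $$ (i,j) * \<sigma> (inv g) $$ (k,b) * \<sigma> h $$ (b,l))"
    by (subst sum.swap) (auto simp: rep_mult_index[OF \<sigma> _ h jk(2) l] sum_distrib_left mult.assoc intro!: sum.cong)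
  also have "\<dots> = (T * \<sigma> h) $$ (i,l)"
    using mult_mat_index[OF T s(1)[OF h] i l] i by (simp add: T_def sum_distrib_right)
  finally show "(\<rho> h * T) $$ (i,l) = (T * \<sigma> h) $$ (i,l)" .
qed (use is_repD(1)[OF \<rho> h] is_repD(1)[OF \<sigma> h] in \<open>auto simp: T_def\<close>)

lemma char_pairing_rep_character:
  assumes "is_rep G n \<rho>" "is_rep G m \<sigma>"
  shows "char_pairing (rep_character G n \<rho>) (rep_character G m \<sigma>)
    = (\<Sum>j<n. \<Sum>k<m. \<Sum>g\<in>carrier G. \<rho> g $$ (j,j) * \<sigma> (inv g) $$ (k,k))"
proof -
  have "char_pairing (rep_character G n \<rho>) (rep_character G m \<sigma>)
    = (\<Sum>g\<in>carrier G. \<Sum>j<n. \<Sum>k<m. \<rho> g $$ (j,j) * \<sigma> (inv g) $$ (k,k))"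
    by (auto simp: char_pairing_def rep_character_def sum_product intro!: sum.cong)
  also have "\<dots> = (\<Sum>j<n. \<Sum>g\<in>carrier G. \<Sum>k<m. \<rho> g $$ (j,j) * \<sigma> (inv g) $$ (k,k))"
    by (rule sum.swap)
  also have "\<dots> = (\<Sum>j<n. \<Sum>k<m. \<Sum>g\<in>carrier G. \<rho> g $$ (j,j) * \<sigma> (inv g) $$ (k,k))"
    by (intro sum.cong refl sum.swap)
  finally show ?thesis .
qed

text \<open>The inner sum for \<open>j\<close> and \<open>k\<close> is the \<open>(j,k)\<close>
  entry of the averaged intertwiner with these same indices. For unequal characters that intertwiner
  is zero by \<open>schur_iso\<close>.\<close>

lemma char_pairing_distinct:
  assumes "\<phi> \<in> Irr G" "\<psi> \<in> Irr G" "\<phi> \<noteq> \<psi>"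
  shows "char_pairing \<phi> \<psi> = 0"
proof -
  obtain n \<rho> where \<rho>: "irreducible_rep G n \<rho>" "\<phi> = rep_character G n \<rho>" using assms(1) unfolding Irr_def by auto
  obtain m \<sigma> where \<sigma>: "irreducible_rep G m \<sigma>" "\<psi> = rep_character G m \<sigma>" using assms(2) unfolding Irr_def by auto
  note r = irreducible_repD(1)[OF \<rho>(1)] and s = irreducible_repD(1)[OF \<sigma>(1)]
  have "(\<Sum>g\<in>carrier G. \<rho> g $$ (j,j) * \<sigma> (inv g) $$ (k,k)) = 0" if jk: "j < n" "k < m" for j k
  proof -
    define T where "T = mat n m (\<lambda>(i,l). \<Sum>g\<in>carrier G. \<rho> g $$ (i,j) * \<sigma> (inv g) $$ (k,l))"
    have "T \<in> carrier_mat n m" by (simp add: T_def)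
    then have "T = 0\<^sub>m n m"
      using schur_iso[OF \<rho>(1) \<sigma>(1), of T] averaged_intertwiner[OF r s jk] assms(3) \<rho>(2) \<sigma>(2)
      unfolding T_def by blast
    then have "T $$ (j,k) = 0" using jk by simp
    then show ?thesis using jk by (simp add: T_def)
  qed
  then show ?thesis unfolding \<rho>(2) \<sigma>(2) char_pairing_rep_character[OF r s] by simp
qed

text \<open>Here the averaged intertwiner is a scalar \<open>c\<close>, determined by its trace:
  \<open>n * c\<close> is |G| if \<open>j = k\<close> and zero otherwise. Only the \<open>n\<close>
  diagonal terms survive, each equal to |G|/n.\<close>

lemma char_pairing_self:
  assumes "\<psi> \<in> Irr G"
  shows "char_pairing \<psi> \<psi> = of_nat (card (carrier G))"
proof -
  obtain n \<rho> where \<rho>: "irreducible_rep G n \<rho>" "\<psi> = rep_character G n \<rho>" using assms(1) unfolding Irr_def by auto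
  note r = irreducible_repD(1)[OF \<rho>(1)] and n = irreducible_repD(2)[OF \<rho>(1)]
  have *: "(\<Sum>g\<in>carrier G. \<rho> g $$ (j,j) * \<rho> (inv g) $$ (k,k)) = (if j = k then of_nat (card (carrier G)) / of_nat n else 0)"
    if jk: "j < n" "k < n" for j k
  proof -
    define T where "T = mat n n (\<lambda>(i,l). \<Sum>g\<in>carrier G. \<rho> g $$ (i,j) * \<rho> (inv g) $$ (k,l))"
    have "T \<in> carrier_mat n n" by (simp add: T_def)
    then obtain c where c: "T = c \<cdot>\<^sub>m 1\<^sub>m n"
      using schur_scalar[OF \<rho>(1), of T] averaged_intertwiner[OF r r jk] unfolding T_def by blast
    have "of_nat n * c = (\<Sum>i<n. T $$ (i,i))" by (simp add: c)
    also have "\<dots> = (\<Sum>g\<in>carrier G. \<Sum>i<n. \<rho> (inv g) $$ (k,i) * \<rho> g $$ (i,j))"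
      by (subst sum.swap) (simp add: T_def mult.commute)
    also have "\<dots> = (\<Sum>g\<in>carrier G. \<rho> (inv g \<otimes> g) $$ (k,j))"
      by (intro sum.cong refl rep_mult_index[OF r inv_closed _ jk(2,1), symmetric])
    also have "\<dots> = (\<Sum>g\<in>carrier G. 1\<^sub>m n $$ (k,j))"
      using is_repD(3)[OF r] by (intro sum.cong) auto
    also have "\<dots> = (if j = k then of_nat (card (carrier G)) else 0)" using jk by simp
    finally have "c = (if j = k then of_nat (card (carrier G)) / of_nat n else 0)"
      using n by (auto simp: field_simps split: if_splits)
    moreover have "T $$ (j,k) = (if j = k then c else 0)" using jk by (simp add: c)
    ultimately show ?thesis using jk by (simp add: T_def)
  qed
  have "char_pairing \<psi> \<psi> = (\<Sum>j<n. \<Sum>k<n. if j = k then of_nat (card (carrier G)) / of_nat n else 0)"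
    unfolding \<rho>(2) char_pairing_rep_character[OF r r] by (intro sum.cong refl) (simp add: *)
  also have "\<dots> = of_nat (card (carrier G))" using n by simp
  finally show ?thesis .
qed

section \<open>Decomposition of characters into irreducible ones\<close>

lemma block_triangular_rep:
  assumes \<sigma>: "is_rep G n \<sigma>" and k: "k \<le> n"
    and zero: "\<And>g i j. g \<in> carrier G \<Longrightarrow> k \<le> i \<Longrightarrow> i < n \<Longrightarrow> j < k \<Longrightarrow> \<sigma> g $$ (i,j) = 0"
  defines "\<sigma>1 \<equiv> \<lambda>g. mat k k (\<lambda>ij. \<sigma> g $$ ij)"
    and "\<sigma>2 \<equiv> \<lambda>g. mat (n - k) (n - k) (\<lambda>(i,j). \<sigma> g $$ (i + k, j + k))"
  shows "is_rep G k \<sigma>1" "is_rep G (n - k) \<sigma>2"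
    "rep_character G n \<sigma> g = rep_character G k \<sigma>1 g + rep_character G (n - k) \<sigma>2 g"
proof -
  show "is_rep G k \<sigma>1" unfolding is_rep_iff
  proof (intro conjI ballI)
    fix g h assume g: "g \<in> carrier G" and h: "h \<in> carrier G"
    show "\<sigma>1 (g \<otimes> h) = \<sigma>1 g * \<sigma>1 h"
    proof (rule eq_matI)
      fix i j assume "i < dim_row (\<sigma>1 g * \<sigma>1 h)" "j < dim_col (\<sigma>1 g * \<sigma>1 h)"
      then have ij: "i < k" "j < k" by (auto simp: \<sigma>1_def)
      have "(\<sigma>1 g * \<sigma>1 h) $$ (i,j) = (\<Sum>l<k. \<sigma>1 g $$ (i,l) * \<sigma>1 h $$ (l,j))"
        using ij by (intro mult_mat_index[of _ k k _ k]) (auto simp: \<sigma>1_def)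
      also have "\<dots> = (\<Sum>l<k. \<sigma> g $$ (i,l) * \<sigma> h $$ (l,j))" using ij by (auto simp: \<sigma>1_def intro!: sum.cong)
      \<comment> \<open>The added terms have \<open>l \<ge> k\<close>, where column \<open>j\<close>
        of \<open>\<sigma> h\<close> vanishes.\<close>
      also have "\<dots> = (\<Sum>l<n. \<sigma> g $$ (i,l) * \<sigma> h $$ (l,j))"
        using zero[OF h, of _ j] ij k by (subst sum_split_lessThan[OF k]) auto
      also have "\<dots> = \<sigma>1 (g \<otimes> h) $$ (i,j)"
        using ij k rep_mult_index[OF \<sigma> g h, of i j] by (simp add: \<sigma>1_def)
      finally show "\<sigma>1 (g \<otimes> h) $$ (i,j) = (\<sigma>1 g * \<sigma>1 h) $$ (i,j)" by simp
    qed (auto simp: \<sigma>1_def)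
  qed (use is_repD(3)[OF \<sigma>] k in \<open>auto simp: \<sigma>1_def\<close>)
  show "is_rep G (n - k) \<sigma>2" unfolding is_rep_iff
  proof (intro conjI ballI)
    fix g h assume g: "g \<in> carrier G" and h: "h \<in> carrier G"
    show "\<sigma>2 (g \<otimes> h) = \<sigma>2 g * \<sigma>2 h"
    proof (rule eq_matI)
      fix i j assume "i < dim_row (\<sigma>2 g * \<sigma>2 h)" "j < dim_col (\<sigma>2 g * \<sigma>2 h)"
      then have ij: "i < n - k" "j < n - k" by (auto simp: \<sigma>2_def)
      have "(\<sigma>2 g * \<sigma>2 h) $$ (i,j) = (\<Sum>l<n - k. \<sigma>2 g $$ (i,l) * \<sigma>2 h $$ (l,j))"
        using ij by (intro mult_mat_index[of _ "n - k" "n - k" _ "n - k"]) (auto simp: \<sigma>2_def)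
      also have "\<dots> = (\<Sum>l<n - k. \<sigma> g $$ (i + k,l + k) * \<sigma> h $$ (l + k,j + k))"
        using ij by (auto simp: \<sigma>2_def intro!: sum.cong)
      \<comment> \<open>Here the zeros come from the other factor: row \<open>i + k\<close> of
        \<open>\<sigma> g\<close> vanishes in the columns below \<open>k\<close>.\<close>
      also have "\<dots> = (\<Sum>l<n. \<sigma> g $$ (i + k,l) * \<sigma> h $$ (l,j + k))"
        using zero[OF g, of "i + k"] ij k by (subst sum_split_lessThan[OF k]) auto
      also have "\<dots> = \<sigma>2 (g \<otimes> h) $$ (i,j)"
        using ij k rep_mult_index[OF \<sigma> g h, of "i + k" "j + k"] by (simp add: \<sigma>2_def)
      finally show "\<sigma>2 (g \<otimes> h) $$ (i,j) = (\<sigma>2 g * \<sigma>2 h) $$ (i,j)" by simp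
    qed (auto simp: \<sigma>2_def)
  qed (use is_repD(3)[OF \<sigma>] k in \<open>auto simp: \<sigma>2_def\<close>)
  show "rep_character G n \<sigma> g = rep_character G k \<sigma>1 g + rep_character G (n - k) \<sigma>2 g"
    by (simp add: rep_character_def sum_split_lessThan[OF k] \<sigma>1_def \<sigma>2_def)
qed

lemma conjugate_rep:
  assumes \<rho>: "is_rep G n \<rho>" and PQ: "P \<in> carrier_mat n n" "Q \<in> carrier_mat n n" "P * Q = 1\<^sub>m n" "Q * P = 1\<^sub>m n"
  shows "is_rep G n (\<lambda>g. Q * (\<rho> g * P))" "rep_character G n (\<lambda>g. Q * (\<rho> g * P)) = rep_character G n \<rho>"
proof -
  note r = is_repD[OF \<rho>]
  show rep: "is_rep G n (\<lambda>g. Q * (\<rho> g * P))" unfolding is_rep_iff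
  proof (intro conjI ballI)
    fix g h assume g: "g \<in> carrier G" and h: "h \<in> carrier G"
    note rg = r(1)[OF g] and rh = r(1)[OF h]
    have "Q * (\<rho> g * P) * (Q * (\<rho> h * P)) = Q * ((\<rho> g * P) * (Q * (\<rho> h * P)))"
      using rg rh PQ by (intro assoc_mult_mat) auto
    also have "(\<rho> g * P) * (Q * (\<rho> h * P)) = \<rho> g * (P * (Q * (\<rho> h * P)))"
      using rg rh PQ by (intro assoc_mult_mat) auto
    also have "P * (Q * (\<rho> h * P)) = P * Q * (\<rho> h * P)"
      using rg rh PQ by (intro assoc_mult_mat[symmetric]) auto
    also have "\<dots> = \<rho> h * P" using rh PQ by simp
    also have "\<rho> g * (\<rho> h * P) = \<rho> (g \<otimes> h) * P"
      using assoc_mult_mat[OF rg rh PQ(1)] r(2)[OF g h] by simp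
    finally show "Q * (\<rho> (g \<otimes> h) * P) = Q * (\<rho> g * P) * (Q * (\<rho> h * P))" by simp
  qed (use r PQ in auto)
  show "rep_character G n (\<lambda>g. Q * (\<rho> g * P)) = rep_character G n \<rho>"
  proof (rule rep_character_similar[OF rep \<rho> PQ(2,1,4,3)])
    fix g assume g: "g \<in> carrier G"
    have "Q * (\<rho> g * P) * Q = Q * ((\<rho> g * P) * Q)" using PQ r(1)[OF g] by (intro assoc_mult_mat) auto
    also have "(\<rho> g * P) * Q = \<rho> g * (P * Q)" using PQ r(1)[OF g] by (intro assoc_mult_mat) auto
    finally show "Q * (\<rho> g * P) * Q = Q * \<rho> g" using PQ r(1)[OF g] by simp
  qed
qed

text \<open>In coordinates adapted to an invariant subspace \<open>W\<close> the matrices are block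
  triangular, and the two diagonal blocks carry the character. As \<open>W\<close> is neither zero
  nor everything, both blocks have positive size.\<close>

lemma rep_character_reducible:
  assumes \<rho>: "is_rep G n \<rho>" and n: "0 < n" and nirr: "\<not> irreducible_rep G n \<rho>"
  obtains k \<rho>1 \<rho>2 where "0 < k" "k < n" "is_rep G k \<rho>1" "is_rep G (n - k) \<rho>2"
    "\<And>g. rep_character G n \<rho> g = rep_character G k \<rho>1 g + rep_character G (n - k) \<rho>2 g"
proof -
  obtain W where W: "invariant_subspace G n \<rho> W" "W \<noteq> {0\<^sub>v n}" "W \<noteq> carrier_vec n"
    using assms unfolding irreducible_rep_def by blast
  have "VectorSpace.subspace class_ring W (module_vec TYPE(complex) n)"
    using W(1) unfolding invariant_subspace_def by blast
  then obtain P Q k where PQ: "P \<in> carrier_mat n n" "Q \<in> carrier_mat n n" "P * Q = 1\<^sub>m n" "Q * P = 1\<^sub>m n"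
    and k: "k \<le> n" and Weq: "W = {P *\<^sub>v x |x. x \<in> carrier_vec n \<and> (\<forall>i. k \<le> i \<longrightarrow> i < n \<longrightarrow> x $ i = 0)}"
    by (rule vec_space.subspace_adapted_basis)
  define \<sigma> where "\<sigma> = (\<lambda>g. Q * (\<rho> g * P))"
  note r = is_repD[OF \<rho>]
  have \<sigma>: "is_rep G n \<sigma>" "rep_character G n \<sigma> = rep_character G n \<rho>"
    unfolding \<sigma>_def using conjugate_rep[OF \<rho> PQ] by auto
  have "k \<noteq> 0"
  proof
    assume "k = 0"
    then have "x = 0\<^sub>v n" if "x \<in> carrier_vec n" "\<forall>i. k \<le> i \<longrightarrow> i < n \<longrightarrow> x $ i = 0" for x :: "complex vec"
      using that by (intro eq_vecI) auto
    then have "W \<subseteq> {0\<^sub>v n}" unfolding Weq using mult_mat_zero_vec[OF PQ(1)] by auto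
    moreover have "0\<^sub>v n \<in> W" using W(1) unfolding invariant_subspace_iff by auto
    ultimately show False using W(2) by auto
  qed
  moreover have "k \<noteq> n"
  proof
    assume "k = n"
    have "v \<in> W" if v: "v \<in> carrier_vec n" for v
    proof -
      have "P *\<^sub>v (Q *\<^sub>v v) = v" using assoc_mult_mat_vec[OF PQ(1,2) v] PQ(3) v by simp
      moreover have "Q *\<^sub>v v \<in> carrier_vec n" using PQ(2) v by auto
      ultimately show ?thesis unfolding Weq using \<open>k = n\<close> by (force intro!: exI[of _ "Q *\<^sub>v v"])
    qed
    then show False using W(1,3) unfolding invariant_subspace_iff by auto
  qed
  \<comment> \<open>\<open>P\<close> sends the unit vector \<open>j < k\<close> into
    \<open>W\<close>, which \<open>\<rho> g\<close> preserves. Column \<open>j\<close> of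
    \<open>\<sigma> g\<close> is therefore supported on the first \<open>k\<close>
    coordinates.\<close>
  moreover have "\<sigma> g $$ (i,j) = 0" if g: "g \<in> carrier G" and i: "k \<le> i" "i < n" and j: "j < k" for g i j
  proof -
    have jn: "j < n" using j k by simp
    have u: "unit_vec n j \<in> carrier_vec n" by simp
    have "P *\<^sub>v unit_vec n j \<in> W"
      unfolding Weq using j by (auto simp: unit_vec_def)
    then have "\<rho> g *\<^sub>v (P *\<^sub>v unit_vec n j) \<in> W" using W(1) g unfolding invariant_subspace_iff by blast
    then obtain x where x: "\<rho> g *\<^sub>v (P *\<^sub>v unit_vec n j) = P *\<^sub>v x" "x \<in> carrier_vec n" "x $ i = 0"
      unfolding Weq using i by blast
    have "\<sigma> g *\<^sub>v unit_vec n j = Q *\<^sub>v ((\<rho> g * P) *\<^sub>v unit_vec n j)"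
      unfolding \<sigma>_def using PQ r(1)[OF g] by (intro assoc_mult_mat_vec) auto
    also have "(\<rho> g * P) *\<^sub>v unit_vec n j = P *\<^sub>v x"
      using assoc_mult_mat_vec[OF r(1)[OF g] PQ(1) u] x(1) by simp
    also have "Q *\<^sub>v (P *\<^sub>v x) = x" using assoc_mult_mat_vec[OF PQ(2,1) x(2)] PQ(4) x(2) by simp
    finally have "(\<sigma> g *\<^sub>v unit_vec n j) $ i = 0" using x(3) by simp
    then show ?thesis using is_repD(1)[OF \<sigma>(1) g] i jn by auto
  qed
  ultimately show thesis
    using that[of k, OF _ _ block_triangular_rep(1,2)[OF \<sigma>(1) k]]
      block_triangular_rep(3)[OF \<sigma>(1) k] k \<sigma>(2) by simp
qed

text \<open>Splitting a reducible character strictly lowers both degrees, so induction on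
  \<open>n\<close> ends in irreducible ones. The multiset records repeated constituents; degree 0
  yields the empty multiset.\<close>

lemma rep_character_decomposition:
  assumes "is_rep G n \<rho>"
  shows "\<exists>M. set_mset M \<subseteq> Irr G \<and> (\<forall>g\<in>carrier G. rep_character G n \<rho> g = (\<Sum>\<psi>\<in>#M. \<psi> g))"
  using assms
proof (induction n arbitrary: \<rho> rule: less_induct)
  case (less n)
  show ?case
  proof (cases "n = 0")
    case True
    then show ?thesis by (intro exI[of _ "{#}"]) (auto simp: rep_character_def)
  next
    case False
    show ?thesis
    proof (cases "irreducible_rep G n \<rho>")
      case True
      then show ?thesis by (intro exI[of _ "{#rep_character G n \<rho>#}"]) (auto simp: Irr_def)
    next
      case nirr: False
      obtain k \<rho>1 \<rho>2 where k: "0 < k" "k < n" "is_rep G k \<rho>1" "is_rep G (n - k) \<rho>2"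
        and *: "\<And>g. rep_character G n \<rho> g = rep_character G k \<rho>1 g + rep_character G (n - k) \<rho>2 g"
        using rep_character_reducible[OF less.prems _ nirr] False by auto
      obtain M1 where "set_mset M1 \<subseteq> Irr G" "\<forall>g\<in>carrier G. rep_character G k \<rho>1 g = (\<Sum>\<psi>\<in>#M1. \<psi> g)"
        using less.IH[OF k(2,3)] by auto
      moreover obtain M2 where "set_mset M2 \<subseteq> Irr G" "\<forall>g\<in>carrier G. rep_character G (n - k) \<rho>2 g = (\<Sum>\<psi>\<in>#M2. \<psi> g)"
        using less.IH[OF _ k(4)] k(1,2) by auto
      ultimately show ?thesis using * by (intro exI[of _ "M1 + M2"]) auto
    qed
  qed
qed

lemma Irr_one_pos:
  assumes "\<psi> \<in> Irr G"
  obtains n where "0 < n" "\<psi> \<one> = of_nat n"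
proof -
  obtain n \<rho> where "irreducible_rep G n \<rho>" "\<psi> = rep_character G n \<rho>" using assms unfolding Irr_def by auto
  then show thesis using that[of n] irreducible_repD(1,2) rep_character_one by metis
qed

end

section \<open>The regular character\<close>

locale finite_group = group +
  assumes fin: "finite (carrier G)"
begin

text \<open>Left multiplication on the enumerated group gives permutation matrices. The trace counts
  fixed points, and a fixed point forces \<open>g = \<one>\<close>.\<close>

lemma regular_rep:
  obtains n \<rho> where "is_rep G n \<rho>"
    "\<And>g. g \<in> carrier G \<Longrightarrow> rep_character G n \<rho> g = (if g = \<one> then of_nat (card (carrier G)) else 0)"
proof -
  let ?N = "card (carrier G)"
  obtain e where e: "bij_betw e {..<?N} (carrier G)"
    using ex_bij_betw_nat_finite[OF fin] by (auto simp: atLeast0LessThan)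
  have eG: "e i \<in> carrier G" if "i < ?N" for i using e that by (auto simp: bij_betw_def)
  have einj: "e i = e j \<longleftrightarrow> i = j" if "i < ?N" "j < ?N" for i j
    using e that by (auto simp: bij_betw_def inj_on_def)
  define \<rho> :: "'a \<Rightarrow> complex mat" where "\<rho> = (\<lambda>g. mat ?N ?N (\<lambda>(i,j). if e i = g \<otimes> e j then 1 else 0))"
  have "is_rep G ?N \<rho>" unfolding is_rep_iff
  proof (intro conjI ballI)
    show "\<rho> \<one> = 1\<^sub>m ?N" by (rule eq_matI) (auto simp: \<rho>_def eG einj)
    fix g h assume g: "g \<in> carrier G" and h: "h \<in> carrier G"
    show "\<rho> g \<in> carrier_mat ?N ?N" by (simp add: \<rho>_def)
    show "\<rho> (g \<otimes> h) = \<rho> g * \<rho> h"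
    proof (rule eq_matI)
      fix i j assume "i < dim_row (\<rho> g * \<rho> h)" "j < dim_col (\<rho> g * \<rho> h)"
      then have ij: "i < ?N" "j < ?N" by (auto simp: \<rho>_def)
      have "h \<otimes> e j \<in> e ` {..<?N}" using e eG[OF ij(2)] h by (auto simp: bij_betw_def)
      \<comment> \<open>Column \<open>j\<close> of \<open>\<rho> h\<close> has its only 1 in row
        \<open>l0\<close>, so the matrix product keeps a single summand.\<close>
      then obtain l0 where l0: "l0 < ?N" "e l0 = h \<otimes> e j" by auto
      have "(\<rho> g * \<rho> h) $$ (i,j) = (\<Sum>l<?N. \<rho> g $$ (i,l) * \<rho> h $$ (l,j))"
        using ij by (intro mult_mat_index[of _ ?N ?N _ ?N]) (auto simp: \<rho>_def)
      also have "\<dots> = (\<Sum>l<?N. if l = l0 then (if e i = g \<otimes> e l0 then 1 else 0) else 0)"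
        using ij l0 einj by (intro sum.cong) (auto simp: \<rho>_def simp flip: l0(2))
      also have "\<dots> = \<rho> (g \<otimes> h) $$ (i,j)"
        using ij l0 g h eG by (simp add: \<rho>_def m_assoc)
      finally show "\<rho> (g \<otimes> h) $$ (i,j) = (\<rho> g * \<rho> h) $$ (i,j)" by simp
    qed (auto simp: \<rho>_def)
  qed
  moreover have "rep_character G ?N \<rho> g = (if g = \<one> then of_nat ?N else 0)" if g: "g \<in> carrier G" for g
  proof -
    have "e i = g \<otimes> e i \<longleftrightarrow> g = \<one>" if "i < ?N" for i
      using eG[OF that] g by simp
    then show ?thesis using g by (simp add: rep_character_def \<rho>_def)
  qed
  ultimately show thesis by (rule that)
qed

text \<open>Pair the regular character with an irreducible \<open>\<psi>\<close>. Orthogonality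
  gives |G| times the multiplicity of \<open>\<psi>\<close> in \<open>M\<close>, while concentration
  at \<open>\<one>\<close> gives |G| times the degree. Degrees are positive, so every irreducible
  character occurs in the finite multiset \<open>M\<close>.\<close>

theorem finite_Irr: "finite (Irr G)"
  and sum_Irr: "g \<in> carrier G \<Longrightarrow> (\<Sum>\<psi>\<in>Irr G. \<psi> \<one> * \<psi> g) = (if g = \<one> then of_nat (card (carrier G)) else 0)"
proof -
  let ?N = "card (carrier G)"
  have N: "?N > 0" using fin card_gt_0_iff by blast
  obtain n \<rho> where \<rho>: "is_rep G n \<rho>"
    and char: "\<And>g. g \<in> carrier G \<Longrightarrow> rep_character G n \<rho> g = (if g = \<one> then of_nat ?N else 0)"
    using regular_rep by blast
  obtain M where M: "set_mset M \<subseteq> Irr G" "\<forall>g\<in>carrier G. rep_character G n \<rho> g = (\<Sum>\<psi>\<in>#M. \<psi> g)"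
    using rep_character_decomposition[OF \<rho>] by blast
  have mult: "\<psi> \<one> = of_nat (count M \<psi>)" if \<psi>: "\<psi> \<in> Irr G" for \<psi>
  proof -
    have lin: "(\<Sum>g\<in>carrier G. (\<Sum>\<phi>\<in>#M. \<phi> g) * \<psi> (inv g)) = (\<Sum>\<phi>\<in>#M. char_pairing \<phi> \<psi>)"
      by (induction M) (auto simp: char_pairing_def sum.distrib distrib_right)
    have "(\<Sum>\<phi>\<in>#M. char_pairing \<phi> \<psi>) = (\<Sum>\<phi>\<in>set_mset M. of_nat (count M \<phi>) * char_pairing \<phi> \<psi>)"
      by (rule sum_mset_eq_sum_count)
    also have "\<dots> = (\<Sum>\<phi>\<in>set_mset M. if \<phi> = \<psi> then of_nat (count M \<psi>) * of_nat ?N else 0)"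
      using M(1) \<psi> char_pairing_distinct char_pairing_self by (intro sum.cong) auto
    also have "\<dots> = of_nat (count M \<psi>) * of_nat ?N" by (auto simp: not_in_iff)
    finally have "of_nat (count M \<psi>) * of_nat ?N = (\<Sum>g\<in>carrier G. rep_character G n \<rho> g * \<psi> (inv g))"
      using lin M(2) by simp
    also have "\<dots> = (\<Sum>g\<in>carrier G. if g = \<one> then of_nat ?N * \<psi> \<one> else 0)"
      using char by (intro sum.cong) auto
    also have "\<dots> = of_nat ?N * \<psi> \<one>" using fin by simp
    finally show ?thesis using N by simp
  qed
  have "\<psi> \<in># M" if "\<psi> \<in> Irr G" for \<psi>
    using mult[OF that] that by (elim Irr_one_pos) (metis count_eq_zero_iff gr_implies_not0 of_nat_eq_iff)
  then have eq: "Irr G = set_mset M" using M(1) by auto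
  then show "finite (Irr G)" by simp
  show "(\<Sum>\<psi>\<in>Irr G. \<psi> \<one> * \<psi> g) = (if g = \<one> then of_nat ?N else 0)" if g: "g \<in> carrier G"
  proof -
    have "(\<Sum>\<psi>\<in>Irr G. \<psi> \<one> * \<psi> g) = (\<Sum>\<psi>\<in>set_mset M. of_nat (count M \<psi>) * \<psi> g)"
      using mult eq by (intro sum.cong) auto
    also have "\<dots> = (\<Sum>\<psi>\<in>#M. \<psi> g)" by (rule sum_mset_eq_sum_count[symmetric])
    finally show ?thesis using M(2) char g by simp
  qed
qed

end

section \<open>Characters trivial on a normal subgroup\<close>

context group begin

lemma normal_set_mult:
  assumes N: "N \<lhd> G" and K: "K \<lhd> G"
  shows "N <#> K \<lhd> G"
  unfolding normal_inv_iff
proof (intro conjI ballI)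
  show "subgroup (N <#> K) G" by (rule mult_norm_subgroup[OF N normal_imp_subgroup[OF K]])
  fix x h assume x: "x \<in> carrier G" and "h \<in> N <#> K"
  then obtain a b where ab: "a \<in> N" "b \<in> K" "h = a \<otimes> b" by (auto simp: set_mult_def)
  have [simp]: "a \<in> carrier G" "b \<in> carrier G"
    using subgroup.mem_carrier[OF normal_imp_subgroup[OF N] ab(1)]
      subgroup.mem_carrier[OF normal_imp_subgroup[OF K] ab(2)] by auto
  have "x \<otimes> h \<otimes> inv x = (x \<otimes> a \<otimes> inv x) \<otimes> (x \<otimes> b \<otimes> inv x)"
  proof -
    have "inv x \<otimes> (x \<otimes> b \<otimes> inv x) = b \<otimes> inv x" using x by (simp add: m_assoc[symmetric])
    then show ?thesis using x ab(3) by (simp add: m_assoc)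
  qed
  moreover have "x \<otimes> a \<otimes> inv x \<in> N" "x \<otimes> b \<otimes> inv x \<in> K"
    using normal.inv_op_closed2[OF N x ab(1)] normal.inv_op_closed2[OF K x ab(2)] by auto
  ultimately show "x \<otimes> h \<otimes> inv x \<in> N <#> K" by (auto simp: set_mult_def)
qed

lemma subset_set_mult:
  assumes "subgroup N G" "subgroup K G"
  shows "N \<subseteq> N <#> K" "K \<subseteq> N <#> K"
proof -
  show "N \<subseteq> N <#> K"
  proof
    fix x assume x: "x \<in> N"
    have "x = x \<otimes> \<one>" using subgroup.mem_carrier[OF assms(1) x] by simp
    then show "x \<in> N <#> K" using x subgroup.one_closed[OF assms(2)] unfolding set_mult_def by blast
  qed
  show "K \<subseteq> N <#> K"
  proof
    fix x assume x: "x \<in> K"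
    have "x = \<one> \<otimes> x" using subgroup.mem_carrier[OF assms(2) x] by simp
    then show "x \<in> N <#> K" using x subgroup.one_closed[OF assms(1)] unfolding set_mult_def by blast
  qed
qed

section \<open>Sums and multiples of characters\<close>

lemma direct_sum_rep:
  assumes \<rho>: "is_rep G n \<rho>" and \<sigma>: "is_rep G m \<sigma>"
  obtains \<tau> where "is_rep G (n + m) \<tau>" "\<And>g. rep_character G (n + m) \<tau> g = rep_character G n \<rho> g + rep_character G m \<sigma> g"
proof -
  note r = is_repD[OF \<rho>] and s = is_repD[OF \<sigma>]
  define \<tau> where "\<tau> = (\<lambda>g. four_block_mat (\<rho> g) (0\<^sub>m n m) (0\<^sub>m m n) (\<sigma> g))"
  have "is_rep G (n + m) \<tau>" unfolding is_rep_iff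
  proof (intro conjI ballI)
    fix g h assume g: "g \<in> carrier G" and h: "h \<in> carrier G"
    show "\<tau> (g \<otimes> h) = \<tau> g * \<tau> h"
      unfolding \<tau>_def using r(1)[OF g] r(1)[OF h] s(1)[OF g] s(1)[OF h] r(2)[OF g h] s(2)[OF g h]
      by (subst mult_four_block_mat[of _ n n _ m _ m _ _ n _ m]) auto
  next
    show "\<tau> \<one> = 1\<^sub>m (n + m)" unfolding \<tau>_def by (rule eq_matI) (auto simp: r s)
  qed (use r s in \<open>auto simp: \<tau>_def\<close>)
  moreover have "rep_character G (n + m) \<tau> g = rep_character G n \<rho> g + rep_character G m \<sigma> g" for g
    using r(1)[of g] s(1)[of g] sum_split_lessThan[of n "n + m" "\<lambda>i. \<tau> g $$ (i,i)"]
    by (auto simp: rep_character_def \<tau>_def)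
  ultimately show thesis by (rule that)
qed

lemma is_character_add:
  assumes "is_character G \<phi>" "is_character G \<psi>"
  shows "is_character G (\<lambda>g. \<phi> g + \<psi> g)"
proof -
  obtain n \<rho> where \<rho>: "0 < n" "is_rep G n \<rho>" "\<phi> = rep_character G n \<rho>" using assms(1) unfolding is_character_def by blast
  obtain m \<sigma> where \<sigma>: "is_rep G m \<sigma>" "\<psi> = rep_character G m \<sigma>" using assms(2) unfolding is_character_def by blast
  obtain \<tau> where \<tau>: "is_rep G (n + m) \<tau>" "\<And>g. rep_character G (n + m) \<tau> g = \<phi> g + \<psi> g"
    using direct_sum_rep[OF \<rho>(2) \<sigma>(1)] \<rho>(3) \<sigma>(2) by metis
  have "0 < n + m" "(\<lambda>g. \<phi> g + \<psi> g) = rep_character G (n + m) \<tau>" using \<rho>(1) \<tau>(2) by auto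
  then show ?thesis unfolding is_character_def using \<tau>(1) by blast
qed

lemma is_character_of_nat_mult:
  assumes "is_character G \<phi>" "0 < n"
  shows "is_character G (\<lambda>g. of_nat n * \<phi> g)"
  using assms(2)
\<comment> \<open>The induction starts at 1: the multiple by 0 is the zero function, which is not a
  character.\<close>
proof (induction n rule: nat_induct_non_zero)
  case 1
  then show ?case using assms(1) by simp
next
  case (Suc n)
  have "(\<lambda>g. of_nat (Suc n) * \<phi> g) = (\<lambda>g. \<phi> g + of_nat n * \<phi> g)" by (auto simp: algebra_simps)
  then show ?case using is_character_add[OF assms(1) Suc.IH] by simp
qed

lemma is_character_Irr: "\<psi> \<in> Irr G \<Longrightarrow> is_character G \<psi>"
  unfolding Irr_def is_character_def using irreducible_repD(1,2) by blast

text \<open>The vectors fixed by \<open>N\<close> form a \<open>G\<close>-invariant subspace, so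
  they are all vectors or only zero. In the second case the sum of the matrices over
  \<open>N\<close>, whose image consists of fixed vectors, vanishes, and with it the trace of its
  product with any \<open>\<rho> g\<close>.\<close>

lemma normal_trivial_or_average_zero:
  assumes \<rho>: "irreducible_rep G n \<rho>" and N: "N \<lhd> G"
  shows "(\<forall>x\<in>N. \<rho> x = 1\<^sub>m n) \<or> (\<forall>g\<in>carrier G. (\<Sum>x\<in>N. rep_character G n \<rho> (x \<otimes> g)) = 0)"
proof -
  note r0 = irreducible_repD(1)[OF \<rho>] note r = is_repD[OF r0]
  have sub: "subgroup N G" by (rule normal_imp_subgroup[OF N])
  have NG: "x \<in> carrier G" if "x \<in> N" for x by (rule subgroup.mem_carrier[OF sub that])
  let ?E = "{v \<in> carrier_vec n. \<forall>x\<in>N. \<rho> x *\<^sub>v v = v}"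
  have inv: "invariant_subspace G n \<rho> ?E" unfolding invariant_subspace_iff
  proof (intro conjI ballI allI)
    show "0\<^sub>v n \<in> ?E" using mult_mat_zero_vec[OF r(1)] NG by auto
  next
    fix v w assume "v \<in> ?E" "w \<in> ?E"
    then show "v + w \<in> ?E" using mult_add_distrib_mat_vec[OF r(1)] NG by auto
  next
    fix c v assume "v \<in> ?E"
    then show "c \<cdot>\<^sub>v v \<in> ?E" using mult_mat_vec[OF r(1)] NG by auto
  next
    fix g v assume g: "g \<in> carrier G" and v: "v \<in> ?E"
    have "\<rho> x *\<^sub>v (\<rho> g *\<^sub>v v) = \<rho> g *\<^sub>v v" if x: "x \<in> N" for x
    proof -
      \<comment> \<open>Normality enters here: \<open>x \<otimes> g\<close> equals
        \<open>g \<otimes> ?y\<close> with \<open>?y\<close> again in \<open>N\<close>.\<close>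
      let ?y = "inv g \<otimes> x \<otimes> g"
      have y: "?y \<in> N" using normal.inv_op_closed1[OF N g x] .
      have "\<rho> x *\<^sub>v (\<rho> g *\<^sub>v v) = \<rho> (x \<otimes> g) *\<^sub>v v"
        using assoc_mult_mat_vec[OF r(1)[OF NG[OF x]] r(1)[OF g]] v r(2)[OF NG[OF x] g] by simp
      also have "x \<otimes> g = g \<otimes> ?y" using NG[OF x] g by (simp add: m_assoc[symmetric])
      also have "\<rho> (g \<otimes> ?y) *\<^sub>v v = \<rho> g *\<^sub>v (\<rho> ?y *\<^sub>v v)"
        using assoc_mult_mat_vec[OF r(1)[OF g] r(1)[OF NG[OF y]]] v r(2)[OF g NG[OF y]] by simp
      finally show ?thesis using v y by simp
    qed
    then show "\<rho> g *\<^sub>v v \<in> ?E" using v r(1)[OF g] by auto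
  qed auto
  show ?thesis
  proof (cases "?E = {0\<^sub>v n}")
    case False
    then have E: "?E = carrier_vec n" using irreducible_repD(3)[OF \<rho> inv] by blast
    have "\<rho> x = 1\<^sub>m n" if x: "x \<in> N" for x
    proof (rule mat_eq_by_vec[OF r(1)[OF NG[OF x]]])
      fix v :: "complex vec" assume v: "v \<in> carrier_vec n"
      then have "v \<in> ?E" using E by blast
      then show "\<rho> x *\<^sub>v v = 1\<^sub>m n *\<^sub>v v" using x v by simp
    qed simp
    then show ?thesis by blast
  next
    case True
    define A where "A = mat n n (\<lambda>ij. \<Sum>x\<in>N. \<rho> x $$ ij)"
    have A: "A \<in> carrier_mat n n" by (simp add: A_def)
    \<comment> \<open>Left multiplication by \<open>y\<close> only permutes the summands of
      \<open>A\<close>.\<close>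
    have fixed: "\<rho> y * A = A" if y: "y \<in> N" for y
    proof (rule eq_matI)
      fix i j assume "i < dim_row A" "j < dim_col A"
      then have ij: "i < n" "j < n" by (auto simp: A_def)
      have "(\<rho> y * A) $$ (i,j) = (\<Sum>l<n. \<Sum>x\<in>N. \<rho> y $$ (i,l) * \<rho> x $$ (l,j))"
        using mult_mat_index[OF r(1)[OF NG[OF y]] A ij] ij by (simp add: A_def sum_distrib_left)
      also have "\<dots> = (\<Sum>x\<in>N. \<rho> (y \<otimes> x) $$ (i,j))"
        using rep_mult_index[OF r0 NG[OF y] NG ij] by (subst sum.swap) simp
      also have "\<dots> = (\<Sum>x\<in>N. \<rho> x $$ (i,j))"
        by (rule sum.reindex_bij_witness[of _ "\<lambda>x. inv y \<otimes> x" "\<lambda>x. y \<otimes> x"])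
           (use y NG sub in \<open>auto simp: m_assoc[symmetric] subgroup.m_closed subgroup.m_inv_closed\<close>)
      finally show "(\<rho> y * A) $$ (i,j) = A $$ (i,j)" using ij by (simp add: A_def)
    qed (use A r(1)[OF NG[OF y]] in auto)
    have "A = 0\<^sub>m n n"
    proof (rule mat_eq_by_vec[OF A])
      fix v :: "complex vec" assume v: "v \<in> carrier_vec n"
      have "\<rho> y *\<^sub>v (A *\<^sub>v v) = A *\<^sub>v v" if y: "y \<in> N" for y
        using assoc_mult_mat_vec[OF r(1)[OF NG[OF y]] A v] fixed[OF y] by simp
      moreover have "A *\<^sub>v v \<in> carrier_vec n" using A v by simp
      ultimately have "A *\<^sub>v v \<in> ?E" by blast
      then have "A *\<^sub>v v = 0\<^sub>v n" using True by blast
      then show "A *\<^sub>v v = 0\<^sub>m n n *\<^sub>v v" using v by (auto intro!: eq_vecI)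
    qed simp
    then have zero: "(\<Sum>x\<in>N. \<rho> x $$ (i,j)) = 0" if "i < n" "j < n" for i j
    proof -
      have "A $$ (i,j) = 0" using \<open>A = 0\<^sub>m n n\<close> that by simp
      then show ?thesis using that by (simp add: A_def)
    qed
    have "(\<Sum>x\<in>N. rep_character G n \<rho> (x \<otimes> g)) = 0" if g: "g \<in> carrier G" for g
    proof -
      have "(\<Sum>x\<in>N. rep_character G n \<rho> (x \<otimes> g)) = (\<Sum>x\<in>N. \<Sum>i<n. \<Sum>l<n. \<rho> x $$ (i,l) * \<rho> g $$ (l,i))"
        using NG g rep_mult_index[OF r0 NG g] by (auto simp: rep_character_def intro!: sum.cong)
      also have "\<dots> = (\<Sum>i<n. \<Sum>x\<in>N. \<Sum>l<n. \<rho> x $$ (i,l) * \<rho> g $$ (l,i))"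
        by (rule sum.swap)
      also have "\<dots> = (\<Sum>i<n. \<Sum>l<n. \<Sum>x\<in>N. \<rho> x $$ (i,l) * \<rho> g $$ (l,i))"
        by (intro sum.cong refl sum.swap)
      also have "\<dots> = (\<Sum>i<n. \<Sum>l<n. (\<Sum>x\<in>N. \<rho> x $$ (i,l)) * \<rho> g $$ (l,i))"
        by (simp add: sum_distrib_right)
      also have "\<dots> = 0" using zero by simp
      finally show ?thesis .
    qed
    then show ?thesis by blast
  qed
qed

text \<open>Linear relations below hold between functions on the whole type, so points outside the
  group must be covered too. Irreducible characters vanish there by convention.\<close>

lemma weighted_sum_outside:
  assumes "X \<subseteq> Irr G" "g \<notin> carrier G"
  shows "weighted_sum G X g = 0"
  unfolding weighted_sum_def using assms by (intro sum.neutral) (auto simp: Irr_def rep_character_def)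

end

section \<open>Kernels of irreducible characters and averages over normal subgroups\<close>

context finite_group begin

lemma is_character_weighted_sum:
  assumes "X \<subseteq> Irr G" "X \<noteq> {}"
  shows "is_character G (weighted_sum G X)"
proof -
  have scaled: "is_character G (\<lambda>g. \<psi> \<one> * \<psi> g)" if \<psi>: "\<psi> \<in> Irr G" for \<psi>
  proof -
    obtain n where n: "0 < n" "\<psi> \<one> = of_nat n" using Irr_one_pos[OF \<psi>] .
    show ?thesis unfolding n(2) by (rule is_character_of_nat_mult[OF is_character_Irr[OF \<psi>] n(1)])
  qed
  have "finite X" using assms(1) finite_Irr finite_subset by blast
  then show ?thesis using assms(2,1)
  proof (induction X rule: finite_ne_induct)
    case (singleton \<psi>)
    then show ?case using scaled by (simp add: weighted_sum_def)
  next
    case (insert \<psi> X)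
    then show ?case using is_character_add[OF scaled, of \<psi> "weighted_sum G X"] by (simp add: weighted_sum_def)
  qed
qed

text \<open>If \<open>N\<close> lies in the kernel, the character sums over \<open>N\<close> to |N|
  times \<open>n\<close>, which is nonzero and rules out a vanishing average. This passes from
  character values to matrices without examining eigenvalues.\<close>

lemma normal_subset_char_ker_iff:
  assumes \<rho>: "irreducible_rep G n \<rho>" and N: "N \<lhd> G"
  shows "N \<subseteq> char_ker G (rep_character G n \<rho>) \<longleftrightarrow> (\<forall>x\<in>N. \<rho> x = 1\<^sub>m n)"
proof
  note r = is_repD[OF irreducible_repD(1)[OF \<rho>]]
  have NG: "N \<subseteq> carrier G" "\<one> \<in> N"
    using normal_imp_subgroup[OF N] subgroup.subset subgroup.one_closed by blast+
  {
    assume "\<forall>x\<in>N. \<rho> x = 1\<^sub>m n"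
    then show "N \<subseteq> char_ker G (rep_character G n \<rho>)"
      using NG r(3) by (auto simp: char_ker_def rep_character_def)
  next
    assume ker: "N \<subseteq> char_ker G (rep_character G n \<rho>)"
    have "(\<Sum>x\<in>N. rep_character G n \<rho> (x \<otimes> \<one>)) = (\<Sum>x\<in>N. of_nat n)"
      using ker NG rep_character_one[OF irreducible_repD(1)[OF \<rho>]]
      by (intro sum.cong) (auto simp: char_ker_def)
    also have "\<dots> \<noteq> 0"
      using irreducible_repD(2)[OF \<rho>] NG finite_subset[OF NG(1) fin] by auto
    finally show "\<forall>x\<in>N. \<rho> x = 1\<^sub>m n"
      using normal_trivial_or_average_zero[OF \<rho> N] one_closed by blast
  }
qed

text \<open>The kernel is defined by character values, which do not multiply, but the matrices do.
  Once \<open>N\<close> and \<open>K\<close> act trivially, so do all products.\<close>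

lemma char_ker_set_mult:
  assumes \<psi>: "\<psi> \<in> Irr G" and N: "N \<lhd> G" "N \<subseteq> char_ker G \<psi>" and K: "K \<lhd> G" "K \<subseteq> char_ker G \<psi>"
  shows "N <#> K \<subseteq> char_ker G \<psi>"
proof -
  obtain n \<rho> where \<rho>: "irreducible_rep G n \<rho>" "\<psi> = rep_character G n \<rho>" using \<psi> unfolding Irr_def by auto
  note r = is_repD[OF irreducible_repD(1)[OF \<rho>(1)]]
  have "\<rho> (x \<otimes> y) = 1\<^sub>m n" if xy: "x \<in> N" "y \<in> K" for x y
  proof -
    have "x \<in> carrier G" "y \<in> carrier G" using xy N K by (auto simp: char_ker_def)
    moreover have "\<rho> x = 1\<^sub>m n" "\<rho> y = 1\<^sub>m n"
      using normal_subset_char_ker_iff[OF \<rho>(1) N(1)] normal_subset_char_ker_iff[OF \<rho>(1) K(1)] xy N(2) K(2) \<rho>(2) by auto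
    ultimately show ?thesis using r(2) by simp
  qed
  then have "\<forall>z\<in>N <#> K. \<rho> z = 1\<^sub>m n" by (auto simp: set_mult_def)
  then show ?thesis using normal_subset_char_ker_iff[OF \<rho>(1) normal_set_mult[OF N(1) K(1)]] \<rho>(2) by simp
qed

text \<open>This expresses membership of \<open>\<psi>\<close> in \<open>irr_over G N\<close> by a
  sum over \<open>N\<close>, to which the regular character can be applied.\<close>

lemma sum_normal_translate:
  assumes \<psi>: "\<psi> \<in> Irr G" and N: "N \<lhd> G" and g: "g \<in> carrier G"
  shows "(\<Sum>x\<in>N. \<psi> (x \<otimes> g)) = (if N \<subseteq> char_ker G \<psi> then of_nat (card N) * \<psi> g else 0)"
proof -
  obtain n \<rho> where \<rho>: "irreducible_rep G n \<rho>" "\<psi> = rep_character G n \<rho>" using \<psi> unfolding Irr_def by auto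
  note r = is_repD[OF irreducible_repD(1)[OF \<rho>(1)]]
  have NG: "N \<subseteq> carrier G" using normal_imp_subgroup[OF N] subgroup.subset by blast
  show ?thesis
  proof (cases "N \<subseteq> char_ker G \<psi>")
    case True
    then have "\<rho> x = 1\<^sub>m n" if "x \<in> N" for x using that normal_subset_char_ker_iff[OF \<rho>(1) N] \<rho>(2) by auto
    then have "\<rho> (x \<otimes> g) = \<rho> g" if "x \<in> N" for x using that r(1)[OF g] r(2)[of x g] g NG by auto
    then have "\<psi> (x \<otimes> g) = \<psi> g" if "x \<in> N" for x using that g NG \<rho>(2) by (auto simp: rep_character_def)
    then show ?thesis using True by simp
  next
    case False
    then show ?thesis using normal_trivial_or_average_zero[OF \<rho>(1) N] normal_subset_char_ker_iff[OF \<rho>(1) N] g \<rho>(2) by auto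
  qed
qed

text \<open>After multiplication by \<open>card N\<close>, averaging over \<open>N\<close> filters
  out \<open>irr_over G N\<close> from a sum over all of \<open>Irr G\<close>. Exchanging the sums
  leaves the regular character at \<open>x \<otimes> g\<close>, nonzero only for
  \<open>x = inv g\<close>, which is in \<open>N\<close> exactly when \<open>g\<close> is.\<close>

lemma weighted_sum_irr_over:
  assumes N: "N \<lhd> G" and g: "g \<in> carrier G"
  shows "weighted_sum G (irr_over G N) g = (if g \<in> N then of_nat (card (carrier G)) / of_nat (card N) else 0)"
proof -
  let ?n = "card (carrier G)"
  have sub: "subgroup N G" by (rule normal_imp_subgroup[OF N])
  have NG: "x \<in> carrier G" if "x \<in> N" for x by (rule subgroup.mem_carrier[OF sub that])
  have finN: "finite N" using fin NG finite_subset[of N] by blast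
  have "card N \<noteq> 0" using finN subgroup.one_closed[OF sub] by auto
  have "of_nat (card N) * weighted_sum G (irr_over G N) g = (\<Sum>\<psi>\<in>irr_over G N. \<psi> \<one> * (of_nat (card N) * \<psi> g))"
    by (simp add: weighted_sum_def sum_distrib_left mult_ac)
  also have "\<dots> = (\<Sum>\<psi>\<in>Irr G. \<psi> \<one> * (\<Sum>x\<in>N. \<psi> (x \<otimes> g)))"
    using finite_Irr sum_normal_translate[OF _ N g]
    by (intro sum.mono_neutral_cong_left) (auto simp: irr_over_def)
  also have "\<dots> = (\<Sum>x\<in>N. \<Sum>\<psi>\<in>Irr G. \<psi> \<one> * \<psi> (x \<otimes> g))"
    unfolding sum_distrib_left by (rule sum.swap)
  also have "\<dots> = (\<Sum>x\<in>N. if x = inv g then of_nat ?n else 0)"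
  proof (rule sum.cong[OF refl])
    fix x assume x: "x \<in> N"
    have "x \<otimes> g = \<one> \<longleftrightarrow> x = inv g" using NG[OF x] g inv_equality by auto
    then show "(\<Sum>\<psi>\<in>Irr G. \<psi> \<one> * \<psi> (x \<otimes> g)) = (if x = inv g then of_nat ?n else 0)"
      using sum_Irr[of "x \<otimes> g"] NG[OF x] g by simp
  qed
  also have "\<dots> = (if g \<in> N then of_nat ?n else 0)"
    using finN subgroup.m_inv_closed[OF sub, of g] subgroup.m_inv_closed[OF sub, of "inv g"] g by auto
  finally show ?thesis using \<open>card N \<noteq> 0\<close> by (auto simp: field_simps split: if_splits)
qed

text \<open>Orthogonality isolates the coefficient of \<open>\<psi>\<close>. The pairing thus
  detects membership in \<open>X\<close>, which later separates the weighted sums of disjoint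
  sets.\<close>

lemma char_pairing_weighted_sum:
  assumes X: "X \<subseteq> Irr G" and \<psi>: "\<psi> \<in> Irr G"
  shows "char_pairing (weighted_sum G X) \<psi> = (if \<psi> \<in> X then \<psi> \<one> * of_nat (card (carrier G)) else 0)"
proof -
  have finX: "finite X" using X finite_Irr finite_subset by blast
  have "char_pairing (weighted_sum G X) \<psi> = (\<Sum>\<phi>\<in>X. \<phi> \<one> * char_pairing \<phi> \<psi>)"
    unfolding char_pairing_def weighted_sum_def sum_distrib_left sum_distrib_right mult.assoc
    by (rule sum.swap)
  also have "\<dots> = (\<Sum>\<phi>\<in>X. if \<phi> = \<psi> then \<psi> \<one> * of_nat (card (carrier G)) else 0)"
    using X \<psi> char_pairing_distinct char_pairing_self by (intro sum.cong) auto
  finally show ?thesis using finX by simp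
qed

lemma weighted_sum_pairing_nonzero:
  assumes "X \<subseteq> Irr G" "\<psi> \<in> X"
  shows "char_pairing (weighted_sum G X) \<psi> \<noteq> 0"
proof -
  have \<psi>: "\<psi> \<in> Irr G" using assms by auto
  obtain n where "0 < n" "\<psi> \<one> = of_nat n" using Irr_one_pos[OF \<psi>] .
  moreover have "card (carrier G) \<noteq> 0" using fin one_closed by auto
  ultimately show ?thesis using char_pairing_weighted_sum[OF assms(1) \<psi>] assms(2) by simp
qed

lemma weighted_sum_nonzero:
  assumes "X \<subseteq> Irr G" "X \<noteq> {}"
  shows "weighted_sum G X \<noteq> (\<lambda>_. 0)"
proof
  assume z: "weighted_sum G X = (\<lambda>_. 0)"
  obtain \<psi> where "\<psi> \<in> X" using assms(2) by blast
  then show False using weighted_sum_pairing_nonzero[OF assms(1)] z by (simp add: char_pairing_def)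
qed

end

section \<open>The supercharacter theory of a lattice of normal subgroups\<close>

text \<open>Inversion for sums over upper sets, by induction on the number of elements above
  \<open>x\<close>. The recursion expands \<open>moebius P x y\<close> into terms
  \<open>moebius P t y\<close> with \<open>x < t \<le> y\<close>; after exchanging the sums, the
  induction hypothesis evaluates each inner sum to \<open>f t\<close>.\<close>

lemma moebius_inversion:
  fixes f F :: "'c :: order \<Rightarrow> 'd :: ring_1"
  assumes P: "finite P" and F: "\<And>x. x \<in> P \<Longrightarrow> F x = (\<Sum>y\<in>{y \<in> P. x \<le> y}. f y)" and x: "x \<in> P"
  shows "(\<Sum>y\<in>{y \<in> P. x \<le> y}. of_int (moebius P x y) * F y) = f x"
  using x
proof (induction "card {y \<in> P. x < y}" arbitrary: x rule: less_induct)
  case less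
  note x = \<open>x \<in> P\<close>
  let ?U = "{y \<in> P. x < y}"
  have split: "{y \<in> P. x \<le> y} = insert x ?U" using x by auto
  have IH: "(\<Sum>y\<in>{y \<in> P. t \<le> y}. of_int (moebius P t y) * F y) = f t" if t: "t \<in> ?U" for t
  proof (rule less.hyps)
    show "card {y \<in> P. t < y} < card ?U" using P t by (intro psubset_card_mono) auto
  qed (use t in auto)
  have "(\<Sum>y\<in>?U. of_int (moebius P x y) * F y) = (\<Sum>y\<in>?U. \<Sum>t\<in>{t \<in> P. x < t \<and> t \<le> y}. - (of_int (moebius P t y) * F y))"
  proof (rule sum.cong[OF refl])
    fix y assume y: "y \<in> ?U"
    have "moebius P x y = - (\<Sum>t\<in>{t \<in> P. x < t \<and> t \<le> y}. moebius P t y)"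
      using P x y by (subst moebius.simps) auto
    then show "of_int (moebius P x y) * F y = (\<Sum>t\<in>{t \<in> P. x < t \<and> t \<le> y}. - (of_int (moebius P t y) * F y))"
      by (simp add: sum_distrib_right sum_negf)
  qed
  also have "\<dots> = (\<Sum>t\<in>?U. \<Sum>y\<in>{y \<in> P. t \<le> y}. - (of_int (moebius P t y) * F y))"
  proof -
    have "{t \<in> P. x < t \<and> t \<le> y} = {t \<in> ?U. t \<le> y}" for y by auto
    moreover have "{y \<in> ?U. t \<le> y} = {y \<in> P. t \<le> y}" if "t \<in> ?U" for t using that by auto
    ultimately show ?thesis
      using sum.swap_restrict[of ?U ?U "\<lambda>y t. - (of_int (moebius P t y) * F y)" "\<lambda>y t. t \<le> y"] P by simp
  qed
  also have "\<dots> = - (\<Sum>t\<in>?U. f t)" using IH by (simp add: sum_negf)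
  finally have "(\<Sum>y\<in>{y \<in> P. x \<le> y}. of_int (moebius P x y) * F y) = F x - (\<Sum>t\<in>?U. f t)"
    unfolding split using P x by (simp add: moebius_refl)
  also have "F x = f x + (\<Sum>t\<in>?U. f t)"
    using F[OF x] P unfolding split by simp
  finally show ?case by simp
qed

section \<open>The lattice of normal subgroups generated by \<open>S\<close>\<close>

locale normal_lattice = finite_group +
  fixes S :: "'a set set"
  assumes S_normal: "S \<subseteq> {N. N \<lhd> G}"
begin

abbreviation A where "A \<equiv> normal_gen G S"

lemma A_normal:
  assumes "N \<in> A"
  shows "N \<lhd> G"
  using assms
proof induction
  case one
  show ?case by (rule one_is_normal)
next
  case whole
  show ?case using subgroup_self by (auto simp: normal_inv_iff)
next
  case (base N)
  then show ?case using S_normal by auto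
next
  case (prod N H)
  then show ?case by (intro normal_set_mult)
next
  case (inter N H)
  then show ?case by (intro normal_subgroup_intersect)
qed

lemma A_subgroup: "N \<in> A \<Longrightarrow> subgroup N G"
  by (rule normal_imp_subgroup[OF A_normal])

lemma A_subset: "N \<in> A \<Longrightarrow> N \<subseteq> carrier G"
  by (rule subgroup.subset[OF A_subgroup])

lemma finite_A: "finite A"
proof (rule finite_subset)
  show "A \<subseteq> Pow (carrier G)" using A_subset by blast
qed (simp add: fin)

section \<open>Irreducible characters sorted by the greatest member of \<open>A\<close> in the
  kernel\<close>

lemma irr_bullet_iff:
  "\<psi> \<in> irr_bullet G S M \<longleftrightarrow> \<psi> \<in> Irr G \<and> M \<subseteq> char_ker G \<psi> \<and> (\<forall>K\<in>A. M \<subset> K \<longrightarrow> \<not> K \<subseteq> char_ker G \<psi>)"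
  by (auto simp: irr_bullet_def irr_over_def)

text \<open>The product \<open>N <#> M\<close> is again in \<open>A\<close> and in the kernel, so it
  cannot exceed the maximal \<open>M\<close>. Closure under products thus upgrades a maximal member
  to a greatest one.\<close>

lemma irr_bullet_greatest:
  assumes M: "M \<in> A" "\<psi> \<in> irr_bullet G S M" and N: "N \<in> A" "N \<subseteq> char_ker G \<psi>"
  shows "N \<subseteq> M"
proof -
  have \<psi>: "\<psi> \<in> Irr G" "M \<subseteq> char_ker G \<psi>" using M(2) irr_bullet_iff by auto
  have "N <#> M \<in> A" using M N by (auto intro: normal_gen.prod)
  moreover have "N <#> M \<subseteq> char_ker G \<psi>"
    by (rule char_ker_set_mult[OF \<psi>(1) A_normal[OF N(1)] N(2) A_normal[OF M(1)] \<psi>(2)])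
  ultimately have "\<not> M \<subset> N <#> M" using M(2) irr_bullet_iff by blast
  then show ?thesis using subset_set_mult[OF A_subgroup[OF N(1)] A_subgroup[OF M(1)]] by blast
qed

lemma irr_bullet_unique:
  assumes "M \<in> A" "N \<in> A" "\<psi> \<in> irr_bullet G S M" "\<psi> \<in> irr_bullet G S N"
  shows "M = N"
proof
  have "M \<subseteq> char_ker G \<psi>" "N \<subseteq> char_ker G \<psi>" using assms irr_bullet_iff by auto
  then show "M \<subseteq> N" "N \<subseteq> M" using irr_bullet_greatest assms by auto
qed

text \<open>By finiteness, \<open>N\<close> lies below a maximal member of \<open>A\<close>
  contained in the kernel of \<open>\<psi>\<close>, and \<open>\<psi>\<close> belongs to the bullet
  set of that member.\<close>

lemma irr_over_eq_Union:
  assumes N: "N \<in> A"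
  shows "irr_over G N = (\<Union>M\<in>{M \<in> A. N \<subseteq> M}. irr_bullet G S M)"
proof (intro equalityI subsetI)
  fix \<psi> assume \<psi>: "\<psi> \<in> irr_over G N"
  let ?C = "{M \<in> A. M \<subseteq> char_ker G \<psi>}"
  obtain M where M: "M \<in> ?C" "N \<subseteq> M" "\<forall>K\<in>?C. M \<subseteq> K \<longrightarrow> M = K"
    using finite_has_maximal2[of ?C N] finite_A N \<psi> by (auto simp: irr_over_def)
  then have "\<psi> \<in> irr_bullet G S M" using \<psi> unfolding irr_bullet_iff by (auto simp: irr_over_def)
  then show "\<psi> \<in> (\<Union>M\<in>{M \<in> A. N \<subseteq> M}. irr_bullet G S M)" using M by blast
qed (auto simp: irr_bullet_iff irr_over_def)

lemma irr_bullet_subset: "irr_bullet G S N \<subseteq> Irr G"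
  by (auto simp: irr_bullet_iff)

lemma weighted_sum_irr_over_bullets:
  assumes N: "N \<in> A"
  shows "weighted_sum G (irr_over G N) g = (\<Sum>M\<in>{M \<in> A. N \<subseteq> M}. char_bullet G S M g)"
  unfolding irr_over_eq_Union[OF N] weighted_sum_def char_bullet_def
proof (rule sum.UNION_disjoint)
  show "finite {M \<in> A. N \<subseteq> M}" using finite_A by simp
  show "\<forall>M\<in>{M \<in> A. N \<subseteq> M}. finite (irr_bullet G S M)"
    using finite_subset[OF irr_bullet_subset finite_Irr] by blast
  show "\<forall>M\<in>{M \<in> A. N \<subseteq> M}. \<forall>K\<in>{M \<in> A. N \<subseteq> M}. M \<noteq> K \<longrightarrow> irr_bullet G S M \<inter> irr_bullet G S K = {}"
    using irr_bullet_unique by blast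
qed

text \<open>Inversion of \<open>weighted_sum_irr_over_bullets\<close> over the poset
  \<open>A\<close>. The restriction to \<open>g \<in> M\<close> arises because the weighted sum of
  \<open>irr_over G M\<close> vanishes off \<open>M\<close>.\<close>

theorem char_bullet_moebius:
  assumes N: "N \<in> A" and g: "g \<in> carrier G"
  shows "char_bullet G S N g = (\<Sum>M\<in>{M \<in> A. g \<in> M \<and> N \<subseteq> M}.
           of_int (moebius A N M) * of_nat (card (carrier G)) / of_nat (card M))"
proof -
  let ?F = "\<lambda>M. weighted_sum G (irr_over G M) g"
  have "char_bullet G S N g = (\<Sum>M\<in>{M \<in> A. N \<subseteq> M}. of_int (moebius A N M) * ?F M)"
    using moebius_inversion[of A ?F "\<lambda>M. char_bullet G S M g", OF finite_A weighted_sum_irr_over_bullets N] by simp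
  also have "\<dots> = (\<Sum>M\<in>{M \<in> A. g \<in> M \<and> N \<subseteq> M}. of_int (moebius A N M) * of_nat (card (carrier G)) / of_nat (card M))"
    using finite_A weighted_sum_irr_over[OF A_normal g] by (intro sum.mono_neutral_cong_right) auto
  finally show ?thesis .
qed

section \<open>Group elements sorted by the least member of \<open>A\<close> containing them\<close>

lemma circ_part_iff:
  assumes "N \<in> A"
  shows "g \<in> circ_part G S N \<longleftrightarrow> g \<in> N \<and> (\<forall>H\<in>A. g \<in> H \<longrightarrow> N \<subseteq> H)"
proof
  assume g: "g \<in> circ_part G S N"
  \<comment> \<open>\<open>N \<inter> H\<close> belongs to \<open>A\<close> and contains
    \<open>g\<close>, so it is not strictly smaller than \<open>N\<close>. This is the dual of the
    product argument for kernels.\<close>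
  have "N \<subseteq> H" if H: "H \<in> A" "g \<in> H" for H
  proof -
    have "N \<inter> H \<in> A" using assms H(1) by (rule normal_gen.inter)
    moreover have "g \<in> N \<inter> H" using g H by (auto simp: circ_part_def)
    ultimately have "\<not> N \<inter> H \<subset> N" using g by (auto simp: circ_part_def)
    then show ?thesis by blast
  qed
  then show "g \<in> N \<and> (\<forall>H\<in>A. g \<in> H \<longrightarrow> N \<subseteq> H)" using g by (auto simp: circ_part_def)
qed (auto simp: circ_part_def)

lemma circ_part_unique:
  assumes "M \<in> A" "N \<in> A" "g \<in> circ_part G S M" "g \<in> circ_part G S N"
  shows "M = N"
  using assms circ_part_iff by blast

lemma circ_part_exists:
  assumes N: "N \<in> A" and g: "g \<in> N"
  obtains M where "M \<in> A" "M \<subseteq> N" "g \<in> circ_part G S M"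
proof -
  let ?C = "{M \<in> A. g \<in> M}"
  obtain M where M: "M \<in> ?C" "M \<subseteq> N" "\<forall>K\<in>?C. K \<subseteq> M \<longrightarrow> M = K"
    using finite_has_minimal2[of ?C N] finite_A N g by auto
  then have "g \<in> circ_part G S M" by (auto simp: circ_part_def)
  then show thesis using that M by blast
qed

section \<open>The two partitions\<close>

definition \<X> where "\<X> = {irr_bullet G S N |N. N \<in> A \<and> irr_bullet G S N \<noteq> {}}"
definition \<K> where "\<K> = {circ_part G S N |N. N \<in> A \<and> circ_part G S N \<noteq> {}}"

lemma partition_\<X>: "partition_on (Irr G) \<X>"
proof (rule partition_onI)
  have one: "{\<one>} \<in> A" by (rule normal_gen.one)
  \<comment> \<open>The identity lies in every kernel, so the members of \<open>A\<close> above the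
    trivial subgroup account for all irreducible characters.\<close>
  have "Irr G = irr_over G {\<one>}" by (auto simp: irr_over_def char_ker_def)
  also have "\<dots> \<subseteq> \<Union>\<X>" unfolding irr_over_eq_Union[OF one] \<X>_def by blast
  finally show "\<Union>\<X> = Irr G" unfolding \<X>_def using irr_bullet_subset by blast
  show "disjnt p q" if "p \<in> \<X>" "q \<in> \<X>" "p \<noteq> q" for p q
    using that irr_bullet_unique unfolding \<X>_def disjnt_def by blast
qed (simp add: \<X>_def)

lemma partition_\<K>: "partition_on (carrier G) \<K>"
proof (rule partition_onI)
  show "\<Union>\<K> = carrier G"
  proof
    show "\<Union>\<K> \<subseteq> carrier G" unfolding \<K>_def using A_subset by (auto simp: circ_part_def)
    show "carrier G \<subseteq> \<Union>\<K>"
    proof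
      fix g assume "g \<in> carrier G"
      then obtain M where "M \<in> A" "g \<in> circ_part G S M"
        using circ_part_exists[OF normal_gen.whole] by blast
      then show "g \<in> \<Union>\<K>" unfolding \<K>_def by blast
    qed
  qed
  show "disjnt p q" if "p \<in> \<K>" "q \<in> \<K>" "p \<noteq> q" for p q
    using that circ_part_unique unfolding \<K>_def disjnt_def by blast
qed (simp add: \<K>_def)

lemma one_in_\<K>: "{\<one>} \<in> \<K>"
proof -
  have "\<one> \<in> H" if "H \<in> A" for H using subgroup.one_closed[OF A_subgroup[OF that]] .
  \<comment> \<open>A member of \<open>A\<close> strictly inside the trivial subgroup would be
    empty.\<close>
  then have "circ_part G S {\<one>} = {\<one>}" by (auto simp: circ_part_def)
  then show ?thesis unfolding \<K>_def using normal_gen.one[of G S] by (intro CollectI exI[of _ "{\<one>}"]) auto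
qed

text \<open>\<open>g\<close> and \<open>h\<close> share the least member \<open>M\<close>, hence lie
  in the same members of \<open>A\<close>. The Moebius formula sees a group element only through
  these memberships.\<close>

lemma char_bullet_constant:
  assumes N: "N \<in> A" and M: "M \<in> A" and gh: "g \<in> circ_part G S M" "h \<in> circ_part G S M"
  shows "char_bullet G S N g = char_bullet G S N h"
proof -
  have mem: "g \<in> H \<longleftrightarrow> h \<in> H" if "H \<in> A" for H using gh that circ_part_iff[OF M] by blast
  have "g \<in> carrier G" "h \<in> carrier G" using gh A_subset[OF M] by (auto simp: circ_part_def)
  moreover have "{K \<in> A. g \<in> K \<and> N \<subseteq> K} = {K \<in> A. h \<in> K \<and> N \<subseteq> K}" using mem by blast
  ultimately show ?thesis using char_bullet_moebius[OF N] by simp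
qed

lemma char_bullet_rational:
  assumes N: "N \<in> A" and g: "g \<in> carrier G"
  shows "char_bullet G S N g \<in> \<rat>"
  unfolding char_bullet_moebius[OF assms] by (intro Rats_sum Rats_divide Rats_mult) auto

lemma \<X>_subset: "X \<in> \<X> \<Longrightarrow> X \<subseteq> Irr G"
  unfolding \<X>_def using irr_bullet_subset by auto

lemma finite_\<X>: "finite \<X>"
  unfolding \<X>_def using finite_A by simp

lemma finite_\<K>: "finite \<K>"
  unfolding \<K>_def using finite_A by simp

section \<open>Equal numbers of parts by linear independence\<close>

lemma pairing_\<X>:
  assumes "X \<in> \<X>" "Y \<in> \<X>" "X \<noteq> Y" "\<psi> \<in> X"
  shows "char_pairing (weighted_sum G Y) \<psi> = 0"
proof -
  have "\<psi> \<notin> Y" using partition_onD2[OF partition_\<X>] assms unfolding disjoint_def by blast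
  moreover have "\<psi> \<in> Irr G" using \<X>_subset[OF assms(1)] assms(4) by blast
  ultimately show ?thesis using char_pairing_weighted_sum[OF \<X>_subset[OF assms(2)]] by simp
qed

lemma inj_on_weighted_sum: "inj_on (weighted_sum G) \<X>"
proof (rule inj_onI, rule ccontr)
  fix X Y assume XY: "X \<in> \<X>" "Y \<in> \<X>" "weighted_sum G X = weighted_sum G Y" "X \<noteq> Y"
  obtain \<psi> where "\<psi> \<in> X" using XY(1) unfolding \<X>_def by blast
  then show False using weighted_sum_pairing_nonzero[OF \<X>_subset[OF XY(1)]] pairing_\<X>[OF XY(1,2,4)] XY(3) by simp
qed

definition ind :: "'a set \<Rightarrow> 'a \<Rightarrow> complex" where "ind K = (\<lambda>g. if g \<in> K then 1 else 0)"

lemma inj_ind: "inj ind"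
  by (rule injI) (auto simp: ind_def fun_eq_iff set_eq_iff split: if_splits)

lemma independent_weighted_sums: "fun_space.independent (weighted_sum G ` \<X>)"
proof (rule independent_if_separated)
  fix f assume "f \<in> (weighted_sum G ` \<X>)"
  then obtain X where X: "X \<in> \<X>" "f = weighted_sum G X" by blast
  obtain \<psi> where \<psi>: "\<psi> \<in> X" using X(1) unfolding \<X>_def by blast
  show "\<exists>L. (\<forall>f h. L (f + h) = L f + L h) \<and> (\<forall>c f. L (\<lambda>g. c * f g) = c * L f) \<and>
     L f \<noteq> (0::complex) \<and> (\<forall>h\<in>(weighted_sum G ` \<X>) - {f}. L h = 0)"
  \<comment> \<open>Pairing with a member of \<open>X\<close> kills the weighted sums of the other
    parts by orthogonality.\<close>
  proof (intro exI[of _ "\<lambda>f. char_pairing f \<psi>"] conjI allI ballI)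
    show "char_pairing f \<psi> \<noteq> 0" unfolding X(2) by (rule weighted_sum_pairing_nonzero[OF \<X>_subset[OF X(1)] \<psi>])
    fix h assume "h \<in> (weighted_sum G ` \<X>) - {f}"
    then show "char_pairing h \<psi> = 0" using pairing_\<X>[OF X(1) _ _ \<psi>] X(2) by auto
  qed (auto simp: char_pairing_def sum.distrib distrib_right sum_distrib_left mult.assoc)
qed

lemma independent_ind: "fun_space.independent (ind ` \<K>)"
proof (rule independent_if_separated)
  fix f assume "f \<in> (ind ` \<K>)"
  then obtain K where K: "K \<in> \<K>" "f = ind K" by blast
  obtain k where k: "k \<in> K" using K(1) unfolding \<K>_def by blast
  show "\<exists>L. (\<forall>f h. L (f + h) = L f + L h) \<and> (\<forall>c f. L (\<lambda>g. c * f g) = c * L f) \<and>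
     L f \<noteq> (0::complex) \<and> (\<forall>h\<in>(ind ` \<K>) - {f}. L h = 0)"
  \<comment> \<open>Evaluation at a point of \<open>K\<close> kills the indicators of the other
    parts, which are disjoint from \<open>K\<close>.\<close>
  proof (intro exI[of _ "\<lambda>f. f k"] conjI allI ballI)
    show "f k \<noteq> 0" using K k by (simp add: ind_def)
    fix h assume "h \<in> (ind ` \<K>) - {f}"
    then obtain K' where "K' \<in> \<K>" "K' \<noteq> K" "h = ind K'" using K(2) by blast
    moreover have "k \<notin> K'"
      using calculation K(1) k partition_onD2[OF partition_\<K>] unfolding disjoint_def by blast
    ultimately show "h k = 0" by (simp add: ind_def)
  qed auto
qed

lemma weighted_sums_in_span: "weighted_sum G ` \<X> \<subseteq> fun_space.span (ind ` \<K>)"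
proof
  fix f assume "f \<in> (weighted_sum G ` \<X>)"
  then obtain N where N: "N \<in> A" "f = weighted_sum G (irr_bullet G S N)" unfolding \<X>_def by blast
  \<comment> \<open>As \<open>f\<close> is constant on each part, any representative gives the same
    value, and these values are the coefficients of \<open>f\<close> with respect to the
    indicators.\<close>
  define v where "v = (\<lambda>K. f (SOME k. k \<in> K))"
  have "f = (\<Sum>K\<in>\<K>. (\<lambda>g. v K * ind K g))"
  proof
    fix g
    have sum_app: "(\<Sum>K\<in>\<K>. (\<lambda>g. v K * ind K g)) g = (\<Sum>K\<in>\<K>. v K * ind K g)"
      by (rule sum_fun_apply)
    show "f g = (\<Sum>K\<in>\<K>. (\<lambda>g. v K * ind K g)) g"
    proof (cases "g \<in> carrier G")
      case False
      then have "g \<notin> K" if "K \<in> \<K>" for K using that partition_onD1[OF partition_\<K>] by blast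
      then have "(\<Sum>K\<in>\<K>. v K * ind K g) = 0" by (intro sum.neutral) (simp add: ind_def)
      then show ?thesis using sum_app weighted_sum_outside[OF irr_bullet_subset False] N(2) by simp
    next
      case True
      then obtain K where K: "K \<in> \<K>" "g \<in> K" using partition_onD1[OF partition_\<K>] by blast
      have "(\<Sum>K'\<in>\<K>. v K' * ind K' g) = (\<Sum>K'\<in>\<K>. if K' = K then v K else 0)"
        using K partition_onD2[OF partition_\<K>] unfolding disjoint_def
        by (intro sum.cong refl) (auto simp: ind_def)
      also have "\<dots> = v K" using K finite_\<K> by simp
      also have "\<dots> = f g"
      proof -
        obtain M where M: "M \<in> A" "K = circ_part G S M" using K(1) unfolding \<K>_def by blast
        have "(SOME k. k \<in> K) \<in> K" using K(2) by (rule someI)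
        then have "char_bullet G S N (SOME k. k \<in> K) = char_bullet G S N g"
          using K(2) unfolding M(2) by (intro char_bullet_constant[OF N(1) M(1)])
        then show ?thesis unfolding v_def N(2) char_bullet_def .
      qed
      finally show ?thesis using sum_app by simp
    qed
  qed
  moreover have "(\<Sum>K\<in>\<K>. (\<lambda>g. v K * ind K g)) \<in> fun_space.span (ind ` \<K>)"
    by (intro fun_space.span_sum fun_space.span_scale fun_space.span_base) auto
  ultimately show "f \<in> fun_space.span (ind ` \<K>)" by simp
qed

text \<open>By \<open>weighted_sum_irr_over\<close> the indicator is a scalar multiple of the
  weighted sum of \<open>irr_over G N\<close>, which splits into bullet characters.\<close>

lemma ind_in_span:
  assumes N: "N \<in> A"
  shows "ind N \<in> fun_space.span (weighted_sum G ` \<X>)"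
proof -
  let ?c = "of_nat (card N) / of_nat (card (carrier G)) :: complex"
  have nz: "card N \<noteq> 0" "card (carrier G) \<noteq> 0"
    using finite_subset[OF A_subset[OF N] fin] subgroup.one_closed[OF A_subgroup[OF N]] fin one_closed by auto
  have w: "weighted_sum G (irr_over G N) = (\<Sum>M\<in>{M \<in> A. N \<subseteq> M}. weighted_sum G (irr_bullet G S M))" (is "_ = ?s")
  proof
    fix g
    have "?s g = (\<Sum>M\<in>{M \<in> A. N \<subseteq> M}. weighted_sum G (irr_bullet G S M) g)"
      by (rule sum_fun_apply)
    then show "weighted_sum G (irr_over G N) g = ?s g"
      using weighted_sum_irr_over_bullets[OF N] by (simp add: char_bullet_def)
  qed
  have eq: "ind N = (\<lambda>g. ?c * weighted_sum G (irr_over G N) g)"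
  proof
    fix g
    show "ind N g = ?c * weighted_sum G (irr_over G N) g"
    proof (cases "g \<in> carrier G")
      case True
      then show ?thesis using weighted_sum_irr_over[OF A_normal[OF N]] nz by (simp add: ind_def)
    next
      case False
      then have "g \<notin> N" using A_subset[OF N] by blast
      moreover have "weighted_sum G (irr_over G N) g = 0"
        using False by (intro weighted_sum_outside) (auto simp: irr_over_def)
      ultimately show ?thesis by (simp add: ind_def)
    qed
  qed
  \<comment> \<open>Empty bullet sets are absent from \<open>\<X>\<close>, but they contribute only
    the zero function, which lies in every span.\<close>
  have bullet: "weighted_sum G (irr_bullet G S M) \<in> fun_space.span (weighted_sum G ` \<X>)" if M: "M \<in> A" for M
  proof (cases "irr_bullet G S M = {}")
    case True
    then have "weighted_sum G (irr_bullet G S M) = 0" by (simp add: weighted_sum_def zero_fun_def)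
    then show ?thesis using fun_space.span_zero by simp
  next
    case False
    then have "irr_bullet G S M \<in> \<X>" using M unfolding \<X>_def by blast
    then show ?thesis by (intro fun_space.span_base imageI)
  qed
  have "weighted_sum G (irr_over G N) \<in> fun_space.span (weighted_sum G ` \<X>)"
    unfolding w using bullet by (intro fun_space.span_sum) auto
  then show ?thesis unfolding eq by (rule fun_space.span_scale)
qed

text \<open>\<open>N\<close> is the disjoint union of the sets \<open>circ_part G S M\<close> over
  the members \<open>M \<subseteq> N\<close> of \<open>A\<close>. Subtracting the parts of the
  smaller \<open>M\<close>, handled by induction on the order, leaves the part of \<open>N\<close>
  itself.\<close>

lemma ind_circ_part_in_span:
  assumes "N \<in> A"
  shows "ind (circ_part G S N) \<in> fun_space.span (weighted_sum G ` \<X>)"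
  using assms
proof (induction "card N" arbitrary: N rule: less_induct)
  case less
  note N = \<open>N \<in> A\<close>
  let ?U = "{M \<in> A. M \<subset> N}"
  have IH: "ind (circ_part G S M) \<in> fun_space.span (weighted_sum G ` \<X>)" if M: "M \<in> ?U" for M
  proof (rule less.hyps)
    show "card M < card N"
      using M finite_subset[OF A_subset[OF N] fin] by (intro psubset_card_mono) auto
  qed (use M in auto)
  have "ind (circ_part G S N) = ind N - (\<Sum>M\<in>?U. ind (circ_part G S M))" (is "_ = _ - ?s")
  proof
    fix g
    have app: "?s g = (\<Sum>M\<in>?U. ind (circ_part G S M) g)"
      by (rule sum_fun_apply)
    show "ind (circ_part G S N) g = (ind N - ?s) g"
    proof (cases "g \<in> N")
      case False
      then have "g \<notin> circ_part G S M" if "M \<subseteq> N" for M using that by (auto simp: circ_part_def)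
      then have "\<forall>M\<in>insert N ?U. ind (circ_part G S M) g = 0" by (auto simp: ind_def)
      then have "?s g = 0" "ind (circ_part G S N) g = 0" unfolding app by auto
      then show ?thesis using False by (simp add: ind_def)
    next
      case True
      \<comment> \<open>Only the part of the least member \<open>M\<close> containing
        \<open>g\<close> contributes at \<open>g\<close>, and it is among the subtracted parts
        unless \<open>M = N\<close>.\<close>
      obtain M where M: "M \<in> A" "M \<subseteq> N" "g \<in> circ_part G S M"
        using circ_part_exists[OF N True] .
      have val: "ind (circ_part G S H) g = (if H = M then 1 else 0)" if "H \<in> A" for H
        using circ_part_unique[OF that M(1)] M(3) by (auto simp: ind_def)
      have "?s g = (\<Sum>H\<in>?U. if H = M then 1 else 0)" unfolding app using val by (intro sum.cong) auto
      also have "\<dots> = (if M = N then 0 else 1)" using finite_A M by auto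
      finally show ?thesis using val[OF N] True by (auto simp: ind_def)
    qed
  qed
  also have "\<dots> \<in> fun_space.span (weighted_sum G ` \<X>)"
    by (intro fun_space.span_diff ind_in_span[OF N] fun_space.span_sum IH)
  finally show ?case .
qed

text \<open>An independent family in the span of a finite family is no larger than it. This bounds
  the two families by each other, and injectivity carries the equality over to the parts.\<close>

lemma card_\<X>_eq_\<K>: "card \<X> = card \<K>"
proof -
  have "ind ` \<K> \<subseteq> fun_space.span (weighted_sum G ` \<X>)" unfolding \<K>_def using ind_circ_part_in_span by blast
  then have "card (ind ` \<K>) \<le> card (weighted_sum G ` \<X>)"
    using fun_space.independent_span_bound[OF finite_imageI[OF finite_\<X>] independent_ind] by blast
  moreover have "card (weighted_sum G ` \<X>) \<le> card (ind ` \<K>)"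
    using fun_space.independent_span_bound[OF finite_imageI[OF finite_\<K>] independent_weighted_sums weighted_sums_in_span]
    by blast
  moreover have "card (weighted_sum G ` \<X>) = card \<X>" by (rule card_image[OF inj_on_weighted_sum])
  moreover have "card (ind ` \<K>) = card \<K>" by (rule card_image[OF inj_on_subset[OF inj_ind subset_UNIV]])
  ultimately show ?thesis by simp
qed

section \<open>The integral supercharacter theory\<close>

lemma integral_theory: "integral_supercharacter_theory G \<X> \<K> (weighted_sum G)"
proof -
  have char: "is_character G (weighted_sum G X)" if "X \<in> \<X>" for X
    using is_character_weighted_sum[OF \<X>_subset[OF that]] that by (auto simp: \<X>_def)
  moreover have "weighted_sum G X g = weighted_sum G X h" if "X \<in> \<X>" "K \<in> \<K>" "g \<in> K" "h \<in> K" for X K g h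
    using that char_bullet_constant unfolding \<X>_def \<K>_def char_bullet_def by blast
  moreover have "weighted_sum G X g \<in> \<rat>" if "X \<in> \<X>" "g \<in> carrier G" for X g
    using that char_bullet_rational unfolding \<X>_def char_bullet_def by blast
  moreover have "\<exists>c. weighted_sum G X = (\<lambda>g. c * weighted_sum G X g)" for X
    by (intro exI[of _ 1]) simp
  ultimately show ?thesis
    unfolding integral_supercharacter_theory_def supercharacter_theory_def integral_character_def
    using partition_\<X> partition_\<K> one_in_\<K> card_\<X>_eq_\<K> by blast
qed

text \<open>By \<open>weighted_sum_nonzero\<close> a bullet character vanishes only if its bullet
  set is empty, so discarding zero functions and discarding empty sets select the same
  \<open>N\<close>.\<close>

lemma weighted_sum_image:
  "weighted_sum G ` \<X> = {char_bullet G S N |N. N \<in> A \<and> char_bullet G S N \<noteq> (\<lambda>_. 0)}"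
proof -
  have "char_bullet G S N \<noteq> (\<lambda>_. 0) \<longleftrightarrow> irr_bullet G S N \<noteq> {}" for N
    using weighted_sum_nonzero[OF irr_bullet_subset] by (auto simp: char_bullet_def weighted_sum_def)
  then show ?thesis unfolding \<X>_def char_bullet_def by auto
qed

end

theorem theorem3p4:
  fixes G :: "('a, 'b) monoid_scheme" (structure)
    and S :: "'a set set"
  assumes "group G"
    and "finite (carrier G)"
    and "S \<subseteq> {N. N \<lhd> G}"
  shows "integral_supercharacter_theory G
           {irr_bullet G S N |N. N \<in> normal_gen G S \<and> irr_bullet G S N \<noteq> {}}
           {circ_part G S N |N. N \<in> normal_gen G S \<and> circ_part G S N \<noteq> {}}
           (weighted_sum G)
         \<and> weighted_sum G ` {irr_bullet G S N |N. N \<in> normal_gen G S \<and> irr_bullet G S N \<noteq> {}}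
           = {char_bullet G S N |N. N \<in> normal_gen G S \<and> char_bullet G S N \<noteq> (\<lambda>_. 0)}
         \<and> (\<forall>N\<in>normal_gen G S. \<forall>g\<in>carrier G.
             char_bullet G S N g =
               (\<Sum>M\<in>{M \<in> normal_gen G S. g \<in> M \<and> N \<subseteq> M}.
                  of_int (moebius (normal_gen G S) N M) * of_nat (card (carrier G)) / of_nat (card M)))"
proof -
  interpret normal_lattice G S
    using assms by (simp add: normal_lattice_def finite_group_def finite_group_axioms_def normal_lattice_axioms_def)
  show ?thesis
    using integral_theory[unfolded \<X>_def \<K>_def] weighted_sum_image[unfolded \<X>_def]
    by (intro conjI ballI char_bullet_moebius)
qed

end
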